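(* Let $\mu=(\mu_k)_{k\ge 0}$ be any probability distribution on $\mathbb{N}=\{0,1,2,\dots\}$ with $\mu_0\in(0,1)$ and $\mu_1=0$, and let $\nu$ be the probability distribution on $\mathbb{N}$ with $\nu(0)=\nu(2)=1/2$. Then for all $n\ge 1$ such that $\mathbf{P}(|\mathrm{T}_\mu|=n)>0$, $$\mathrm{ht}(\mathrm{T}_{\mu,n})\preceq_{\mathrm{st}}\mathrm{ht}(\mathrm{T}_{\nu,n})\ \text{ if } n \text{ is odd},\qquad \mathrm{ht}(\mathrm{T}_{\mu,n})\preceq_{\mathrm{st}}\mathrm{ht}(\mathrm{T}_{\nu,n+1})\ \text{ if } n\text{ is even}.$$
   Context: For random variables $X,Y$, $X\preceq_{\mathrm{st}}Y$ means $\mathbf{P}(X\le t)\ge\mathbf{P}(Y\le t)$ for all $t\in\mathbb{R}$. A plane tree is a rooted, unlabeled finite tree in which the set of children of each node carries a (left-to-right) total order. For a probability distribution $\mu$ on $\mathbb{N}$, $\mathrm{T}_\mu$ is the Bienaymé (Galton–Watson) tree with offspring distribution $\mu$, i.e. the family tree of a branching process with offspring distribution $\mu$; for every finite plane tree $\mathrm{t}$, $\mathbf{P}(\mathrm{T}_\mu=\mathrm{t})=\prod_{v}\mu_{d_{\mathrm{t}}(v)}$, where the product is over vertices $v$ of $\mathrm{t}$ and $d_{\mathrm{t}}(v)$ is the number of children of $v$. $|\mathrm{T}_\mu|$ is its number of vertices, and for $n$ with $\mathbf{P}(|\mathrm{T}_\mu|=n)>0$, $\mathrm{T}_{\mu,n}$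 is $\mathrm{T}_\mu$ conditioned to have exactly $n$ vertices. The height $\mathrm{ht}(\mathrm{t})$ is the maximum graph distance from the root to a vertex of $\mathrm{t}$. *)

theory Defs
  imports "HOL-Probability.Probability"
begin

text \<open>
  Plane trees, finite or infinite, are encoded by Ulam-Harris words: the root is \<open>[]\<close> and the
  children of a vertex \<open>u\<close> with \<open>k\<close> children are \<open>u @ [0], \<dots>, u @ [k - 1]\<close>, from left to right.
  Here \<open>\<xi> u\<close> is the number of children that \<open>u\<close> has if it is born; its value
  is irrelevant if \<open>u\<close> is not.
\<close>

inductive_set family_tree :: "(nat list \<Rightarrow> nat) \<Rightarrow> nat list set"
  for \<xi> :: "nat list \<Rightarrow> nat" where
  root: "[] \<in> family_tree \<xi>"
| child: "u \<in> family_tree \<xi> \<Longrightarrow> i < \<xi> u \<Longrightarrow> u @ [i] \<in> family_tree \<xi>"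

text \<open>
  The distance of a vertex from the root is the length of its word. The value is
  meaningful for finite trees only.
\<close>

definition tree_height :: "nat list set \<Rightarrow> nat" where
  "tree_height T = Max (length ` T)"

definition has_size :: "nat list set \<Rightarrow> nat \<Rightarrow> bool" where
  "has_size T n \<longleftrightarrow> finite T \<and> card T = n"

text \<open>
  The offspring numbers of a branching process are independent with law \<open>\<mu>\<close>; on this
  probability space the Bienayme tree is the random tree \<open>family_tree\<close>. It may be infinite.
\<close>

definition branching :: "nat pmf \<Rightarrow> (nat list \<Rightarrow> nat) measure" where
  "branching \<mu> = (\<Pi>\<^sub>M u\<in>UNIV. measure_pmf \<mu>)"

text \<open>
  Conditioning on an event of positive probability; under this measure \<open>family_tree\<close> is
  the Bienayme tree conditioned to have \<open>n\<close> vertices.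
\<close>

definition cond_branching :: "nat pmf \<Rightarrow> nat \<Rightarrow> (nat list \<Rightarrow> nat) measure" where
  "cond_branching \<mu> n =
     uniform_measure (branching \<mu>) {\<xi> \<in> space (branching \<mu>). has_size (family_tree \<xi>) n}"

definition stoch_le ::
  "'a measure \<Rightarrow> ('a \<Rightarrow> real) \<Rightarrow> 'b measure \<Rightarrow> ('b \<Rightarrow> real) \<Rightarrow> bool" where
  "stoch_le M X N Y \<longleftrightarrow> (\<forall>t. \<P>(x in M. X x \<le> t) \<ge> \<P>(y in N. Y y \<le> t))"

lemma space_branching [simp]: "space (branching \<mu>) = UNIV"
  by (simp add: branching_def space_PiM)

lemma snoc_in_family_tree_iff:
  "u @ [i] \<in> family_tree \<xi> \<longleftrightarrow> u \<in> family_tree \<xi> \<and> i < \<xi> u"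
proof
  assume "u @ [i] \<in> family_tree \<xi>"
  then show "u \<in> family_tree \<xi> \<and> i < \<xi> u" by cases auto
qed (simp add: family_tree.child)

lemma family_tree_eq_iff:
  "family_tree \<xi> = family_tree d \<longleftrightarrow> (\<forall>v\<in>family_tree d. \<xi> v = d v)"
proof
  assume eq: "family_tree \<xi> = family_tree d"
  show "\<forall>v\<in>family_tree d. \<xi> v = d v"
  proof
    fix v assume "v \<in> family_tree d"
    then have "i < \<xi> v \<longleftrightarrow> i < d v" for i
      using snoc_in_family_tree_iff[of v i \<xi>] snoc_in_family_tree_iff[of v i d] eq
      by simp
    then show "\<xi> v = d v" by (metis linorder_neqE_nat less_irrefl)
  qed
next
  assume eq: "\<forall>v\<in>family_tree d. \<xi> v = d v"
  have "u \<in> family_tree \<xi> \<longleftrightarrow> u \<in> family_tree d" for u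
    by (induction u rule: rev_induct)
      (use eq in \<open>auto simp: snoc_in_family_tree_iff intro: family_tree.root\<close>)
  then show "family_tree \<xi> = family_tree d" by blast
qed

lemma family_tree_eq_emb:
  "{\<xi>. family_tree \<xi> = family_tree d}
     = prod_emb UNIV (\<lambda>_. measure_pmf \<mu>) (family_tree d) (Pi\<^sub>E (family_tree d) (\<lambda>v. {d v}))"
  by (auto simp: family_tree_eq_iff prod_emb_def PiE_iff restrict_def)

lemma prob_family_tree_eq:
  assumes "finite (family_tree d)"
  shows "\<P>(\<xi> in branching \<mu>. family_tree \<xi> = family_tree d)
           = (\<Prod>v\<in>family_tree d. pmf \<mu> (d v))"
proof -
  interpret product_prob_space "\<lambda>_. measure_pmf \<mu>" "UNIV :: nat list set"
    by standard
  show ?thesis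
    using family_tree_eq_emb[of d \<mu>] measure_PiM_emb[of "family_tree d" "\<lambda>v. {d v}"] assms
    by (simp add: branching_def space_PiM measure_pmf_single)
qed

lemma sets_family_tree_eq:
  assumes "finite (family_tree d)"
  shows "{\<xi>. family_tree \<xi> = family_tree d} \<in> sets (branching \<mu>)"
  using assms by (simp add: branching_def family_tree_eq_emb[of d \<mu>])

lemma sets_family_tree:
  assumes "\<And>T. P T \<Longrightarrow> finite T"
  shows "{\<xi>. P (family_tree \<xi>)} \<in> sets (branching \<mu>)"
proof -
  let ?F = "{T \<in> range family_tree. P T}"
  have "?F \<subseteq> Collect finite" using assms by blast
  then have "countable ?F"
    using countable_Collect_finite countable_subset by blast
  moreover have "{\<xi>. family_tree \<xi> = T} \<in> sets (branching \<mu>)" if "T \<in> ?F" for T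
    using that assms sets_family_tree_eq by blast
  ultimately have "(\<Union>T\<in>?F. {\<xi>. family_tree \<xi> = T}) \<in> sets (branching \<mu>)"
    by (intro sets.countable_UN'') auto
  also have "(\<Union>T\<in>?F. {\<xi>. family_tree \<xi> = T}) = {\<xi>. P (family_tree \<xi>)}"
    by auto
  finally show ?thesis .
qed

lemma finite_family_tree_level: "finite {u \<in> family_tree \<xi>. length u = k}"
proof (induction k)
  case 0
  have "{u \<in> family_tree \<xi>. length u = 0} \<subseteq> {[]}" by auto
  then show ?case using finite_subset by blast
next
  case (Suc k)
  have "{u \<in> family_tree \<xi>. length u = Suc k}
      \<subseteq> (\<Union>u\<in>{u \<in> family_tree \<xi>. length u = k}. (\<lambda>i. u @ [i]) ` {..<\<xi> u})"
  proof
    fix v assume "v \<in> {u \<in> family_tree \<xi>. length u = Suc k}"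
    then have "v \<in> family_tree \<xi>" "length v = Suc k" by auto
    then show "v \<in> (\<Union>u\<in>{u \<in> family_tree \<xi>. length u = k}. (\<lambda>i. u @ [i]) ` {..<\<xi> u})"
      by cases auto
  qed
  moreover have "finite \<dots>" using Suc by blast
  ultimately show ?case by (rule finite_subset)
qed

lemma tree_height_infinite:
  assumes "infinite (family_tree \<xi>)"
  shows "tree_height (family_tree \<xi>) = the None"
proof -
  have "family_tree \<xi> = (\<Union>k\<in>length ` family_tree \<xi>. {u \<in> family_tree \<xi>. length u = k})"
    by auto
  then have "infinite (length ` family_tree \<xi>)"
    using assms finite_family_tree_level by (metis (no_types, lifting) finite_UN_I)
  then show ?thesis by (simp add: tree_height_def Max.infinite)
qed

lemma measurable_tree_height:
  "(\<lambda>\<xi>. real (tree_height (family_tree \<xi>))) \<in> borel_measurable (branching \<mu>)"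
proof -
  have "{\<xi>. tree_height (family_tree \<xi>) = k} \<in> sets (branching \<mu>)" for k
  proof -
    have "{\<xi>. finite (family_tree \<xi>)} \<in> sets (branching \<mu>)"
      by (rule sets_family_tree)
    then have fin: "- {\<xi>. finite (family_tree \<xi>)} \<in> sets (branching \<mu>)"
      by (metis Compl_eq_Diff_UNIV sets.compl_sets space_branching)
    have kfin: "{\<xi>. finite (family_tree \<xi>) \<and> tree_height (family_tree \<xi>) = k}
        \<in> sets (branching \<mu>)"
      by (rule sets_family_tree) simp
    have "{\<xi>. tree_height (family_tree \<xi>) = k}
        = {\<xi>. finite (family_tree \<xi>) \<and> tree_height (family_tree \<xi>) = k}
          \<union> (if the None = k then - {\<xi>. finite (family_tree \<xi>)} else {})"
      using tree_height_infinite by (force split: if_splits)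
    also have "\<dots> \<in> sets (branching \<mu>)"
      using fin kfin by auto
    finally show ?thesis .
  qed
  then have "(\<lambda>\<xi>. tree_height (family_tree \<xi>)) \<in> branching \<mu> \<rightarrow>\<^sub>M count_space UNIV"
    by (subst measurable_count_space_eq2_countable) (auto simp: vimage_def)
  then show ?thesis by (rule measurable_compose) simp
qed

end

theory Submission
  imports Defs "HOL-Library.Poly_Mapping"
begin

text \<open>
  Given its multiset \<open>m\<close> of degrees, the conditioned tree is a uniform plane tree, so it is enough to
  compare degree multisets. Let \<open>T\<^sub>0 = 0\<close> and \<open>T\<^sub>h\<^sub>+\<^sub>1 = (\<Sum>k\<le>K. x\<^sub>k T\<^sub>h\<^sup>k)\<close>; the coefficient of \<open>m\<close> in \<open>T\<^sub>h\<close> counts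
  the trees with degrees \<open>m\<close> and height less than \<open>h\<close>. Writing \<open>\<partial>\<^sub>a\<close> for the derivative in \<open>x\<^sub>a\<close>, the
  recursion shows that \<open>\<partial>\<^sub>a\<partial>\<^sub>b T\<^sub>h\<close> decreases coefficientwise when \<open>(a, b)\<close> with \<open>a > b\<close> is replaced by
  \<open>(a - 1, b + 1)\<close>, the inequality behind this being \<open>(z\<^sup>l - y\<^sup>l) (z - y) \<ge> 0\<close> for \<open>0 \<le> y \<le> z\<close>. In the limit
  \<open>h \<rightarrow> \<infinity>\<close>, however, \<open>\<partial>\<^sub>a\<partial>\<^sub>b T\<close> depends on \<open>a + b\<close> only. Hence replacing degrees \<open>a, b\<close> by
  \<open>a - 1, b + 1\<close> makes the tree stochastically taller; likewise, comparing \<open>\<partial>\<^sub>1\<close> with the Euler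
  operator, so does adding a vertex of degree 1. If \<open>m\<close> has odd size and at most one entry 1,
  the moves \<open>(k, 0) \<mapsto> (k - 1, 1)\<close> and \<open>(k, 1) \<mapsto> (k - 1, 2)\<close> with \<open>k \<ge> 3\<close> lead to the degrees of a binary
  tree; if \<open>m\<close> has even size, first add a vertex of degree 1.
\<close>

section \<open>Polynomials indexed by multisets\<close>

type_synonym 'a mpoly = "('a multiset, real) poly_mapping"

lemma poly_mapping_single_induct [case_names zero single]:
  fixes p :: "('a, 'b::comm_monoid_add) poly_mapping"
  assumes "P 0" and "\<And>k c p. P p \<Longrightarrow> P (Poly_Mapping.single k c + p)"
  shows "P p"
proof (induction p rule: update_induct)
  case const
  then show ?case using assms(1) by simp
next
  case (update f a b)
  have "Poly_Mapping.update a b f = Poly_Mapping.single a b + f"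
    using update
    by (intro poly_mapping_eqI)
      (auto simp: lookup_update lookup_add lookup_single when_def in_keys_iff)
  then show ?case using assms(2)[OF update(3)] by simp
qed

section \<open>Coefficientwise nonnegativity\<close>

definition nonneg :: "'a mpoly \<Rightarrow> bool" where
  "nonneg p \<longleftrightarrow> (\<forall>m. 0 \<le> Poly_Mapping.lookup p m)"

lemma nonneg_0 [simp]: "nonneg 0"
  by (simp add: nonneg_def)

lemma nonneg_single [simp]: "0 \<le> c \<Longrightarrow> nonneg (Poly_Mapping.single m c)"
  by (simp add: nonneg_def lookup_single when_def)

lemma nonneg_1 [simp]: "nonneg 1"
  by (simp add: nonneg_def lookup_one when_def)

lemma nonneg_add: "nonneg p \<Longrightarrow> nonneg q \<Longrightarrow> nonneg (p + q)"
  by (simp add: nonneg_def lookup_add)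

lemma nonneg_mult: "nonneg p \<Longrightarrow> nonneg q \<Longrightarrow> nonneg (p * q)"
  unfolding nonneg_def lookup_mult Sum_any.expand_set
  by (auto intro!: sum_nonneg mult_nonneg_nonneg simp: when_def)

lemma nonneg_of_nat [simp]: "nonneg (of_nat n)"
  by (induction n) (simp_all add: nonneg_add)

lemma nonneg_power: "nonneg p \<Longrightarrow> nonneg (p ^ n)"
  by (induction n) (simp_all add: nonneg_mult)

lemma nonneg_sum: "(\<And>i. i \<in> I \<Longrightarrow> nonneg (f i)) \<Longrightarrow> nonneg (sum f I)"
  by (induction I rule: infinite_finite_induct) (simp_all add: nonneg_add)

lemma nonneg_prod: "(\<And>i. i \<in> I \<Longrightarrow> nonneg (f i)) \<Longrightarrow> nonneg (prod f I)"
  by (induction I rule: infinite_finite_induct) (simp_all add: nonneg_mult)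

lemma nonneg_half: "nonneg (p + p) \<Longrightarrow> nonneg p"
  unfolding nonneg_def lookup_add by simp

lemmas nonneg_intros = nonneg_add nonneg_mult nonneg_power nonneg_sum nonneg_prod

lemma nonneg_of_diff: "nonneg y \<Longrightarrow> nonneg (z - y) \<Longrightarrow> nonneg z"
  using nonneg_add[of y "z - y"] by simp

lemma nonneg_diff_power:
  assumes "nonneg y" "nonneg (z - y)"
  shows "nonneg (z ^ k - y ^ k)"
proof (induction k)
  case (Suc k)
  have "z ^ Suc k - y ^ Suc k = z * (z ^ k - y ^ k) + (z - y) * y ^ k"
    by (simp add: algebra_simps)
  then show ?case
    using Suc assms nonneg_of_diff[OF assms] by (simp add: nonneg_intros)
qed simp

lemma nonneg_balance_power:
  assumes "nonneg y" "nonneg (z - y)"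
  shows "nonneg (z ^ Suc (b + l) * y ^ b + y ^ Suc (b + l) * z ^ b
                 - (z ^ (b + l) * y ^ Suc b + y ^ (b + l) * z ^ Suc b))"
proof -
  have "z ^ Suc (b + l) * y ^ b + y ^ Suc (b + l) * z ^ b
          - (z ^ (b + l) * y ^ Suc b + y ^ (b + l) * z ^ Suc b)
        = y ^ b * z ^ b * (z ^ l - y ^ l) * (z - y)"
    by (simp add: algebra_simps power_add)
  then show ?thesis
    using assms nonneg_of_diff[OF assms] nonneg_diff_power[OF assms, of l]
    by (simp add: nonneg_intros)
qed

text \<open>The expression is the formal derivative in \<open>z\<close> of the one in
  \<open>nonneg_balance_power\<close>. The product rule, applied to the factored form, gives a sum
  of nonnegative terms.\<close>

lemma nonneg_balance_deriv:
  assumes "nonneg y" "nonneg (z - y)"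
  shows "nonneg (of_nat (Suc (b + l)) * z ^ (b + l) * y ^ b + of_nat b * z ^ (b - 1) * y ^ Suc (b + l)
                 - (of_nat (b + l) * z ^ (b + l - 1) * y ^ Suc b + of_nat (Suc b) * z ^ b * y ^ (b + l)))"
    (is "nonneg ?d")
proof -
  have "?d = y ^ b * (of_nat b * z ^ (b - 1) * (z - y) * (z ^ l - y ^ l)
          + z ^ b * (of_nat l * z ^ (l - 1) * (z - y) + (z ^ l - y ^ l)))"
    by (cases b; cases l) (simp_all add: algebra_simps power_add)
  then show ?thesis
    using assms nonneg_of_diff[OF assms] nonneg_diff_power[OF assms, of l]
    by (simp add: nonneg_intros del: of_nat_Suc)
qed

section \<open>Congruences modulo monomials of high degree\<close>

text \<open>The limit of unbounded height is expressed by congruences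
  \<open>ord_ge M (p - q)\<close>, which identify all coefficients of degree below \<open>M\<close>,
  in place of power series.\<close>

definition ord_ge :: "nat \<Rightarrow> 'a mpoly \<Rightarrow> bool" where
  "ord_ge M p \<longleftrightarrow> (\<forall>m\<in>Poly_Mapping.keys p. M \<le> size m)"

lemma ord_geI: "(\<And>m. size m < M \<Longrightarrow> Poly_Mapping.lookup p m = 0) \<Longrightarrow> ord_ge M p"
  by (auto simp: ord_ge_def in_keys_iff intro: leI)

lemma ord_geD: "ord_ge M p \<Longrightarrow> size m < M \<Longrightarrow> Poly_Mapping.lookup p m = 0"
  unfolding ord_ge_def by (meson in_keys_iff leD)

lemma ord_ge_diffD:
  "ord_ge M (p - q) \<Longrightarrow> size m < M \<Longrightarrow> Poly_Mapping.lookup p m = Poly_Mapping.lookup q m"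
  using ord_geD[of M "p - q" m] by (simp add: lookup_minus)

lemma ord_ge_0 [simp]: "ord_ge M 0"
  by (simp add: ord_ge_def)

lemma ord_ge_zero [simp]: "ord_ge 0 p"
  by (simp add: ord_ge_def)

lemma ord_ge_mono: "ord_ge M p \<Longrightarrow> N \<le> M \<Longrightarrow> ord_ge N p"
  by (auto simp: ord_ge_def)

lemma ord_ge_add: "ord_ge M p \<Longrightarrow> ord_ge M q \<Longrightarrow> ord_ge M (p + q)"
  by (rule ord_geI) (simp add: lookup_add ord_geD)

lemma ord_ge_diff: "ord_ge M p \<Longrightarrow> ord_ge M q \<Longrightarrow> ord_ge M (p - q)"
  by (rule ord_geI) (simp add: lookup_minus ord_geD)

lemma ord_ge_mult: "ord_ge M p \<Longrightarrow> ord_ge N q \<Longrightarrow> ord_ge (M + N) (p * q)"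
  unfolding ord_ge_def
proof
  fix m assume pq: "\<forall>m\<in>Poly_Mapping.keys p. M \<le> size m" "\<forall>m\<in>Poly_Mapping.keys q. N \<le> size m"
    and "m \<in> Poly_Mapping.keys (p * q)"
  then obtain a b where "m = a + b" "a \<in> Poly_Mapping.keys p" "b \<in> Poly_Mapping.keys q"
    using keys_mult[of p q] by blast
  then show "M + N \<le> size m" using pq by (simp add: add_mono)
qed

lemma ord_ge_mult_left: "ord_ge M q \<Longrightarrow> ord_ge M (p * q)"
  using ord_ge_mult[of 0 p M q] by simp

lemma ord_ge_mult_right: "ord_ge M p \<Longrightarrow> ord_ge M (p * q)"
  using ord_ge_mult[of M p 0 q] by simp

lemma ord_ge_sum: "(\<And>i. i \<in> I \<Longrightarrow> ord_ge M (f i)) \<Longrightarrow> ord_ge M (sum f I)"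
  by (induction I rule: infinite_finite_induct) (simp_all add: ord_ge_add)

lemmas ord_ge_intros = ord_ge_add ord_ge_diff ord_ge_mult_left ord_ge_mult_right

lemma ord_ge_diff_power: "ord_ge M (z - y) \<Longrightarrow> ord_ge M (z ^ k - y ^ k)"
proof (induction k)
  case (Suc k)
  have "z ^ Suc k - y ^ Suc k = z * (z ^ k - y ^ k) + (z - y) * y ^ k"
    by (simp add: algebra_simps)
  then show ?case using Suc by (simp add: ord_ge_intros)
qed simp

text \<open>The geometric series \<open>1 / (1 - d)\<close> does not lower the order.\<close>

lemma ord_ge_of_fixpoint:
  assumes "ord_ge 1 d" "ord_ge M (p - d * p)"
  shows "ord_ge M p"
proof -
  \<comment> \<open>The order climbs one unit at a time: \<open>p\<close> is the sum of
    \<open>p - d * p\<close> and \<open>d * p\<close>, and \<open>d\<close> has no constant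
    term.\<close>
  have "ord_ge j p" if "j \<le> M" for j
    using that
  proof (induction j)
    case (Suc j)
    then have "ord_ge (Suc j) (d * p)"
      using ord_ge_mult[OF assms(1), of j p] by simp
    moreover have "ord_ge (Suc j) (p - d * p)"
      using assms(2) Suc.prems by (rule ord_ge_mono)
    ultimately show ?case using ord_ge_add by fastforce
  qed simp
  then show ?thesis by simp
qed

section \<open>Partial derivatives and the Euler operator\<close>

locale derivation =
  fixes D :: "'r::comm_ring_1 \<Rightarrow> 'r"
  assumes add: "D (x + y) = D x + D y"
    and mult: "D (x * y) = D x * y + x * D y"
begin

lemma zero [simp]: "D 0 = 0"
  using add[of 0 0] by simp

lemma one [simp]: "D 1 = 0"
  using mult[of 1 1] by simp

lemma of_nat [simp]: "D (of_nat n) = 0"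
  by (induction n) (simp_all add: add)

lemma diff: "D (x - y) = D x - D y"
  using add[of "x - y" y] by simp

lemma sum: "D (sum f I) = (\<Sum>i\<in>I. D (f i))"
  by (induction I rule: infinite_finite_induct) (simp_all add: add)

lemma power: "D (x ^ n) = of_nat n * x ^ (n - 1) * D x"
proof (induction n)
  case (Suc n)
  then show ?case by (cases n) (simp_all add: mult algebra_simps)
qed simp

end

lift_definition pdiff :: "'a \<Rightarrow> 'a mpoly \<Rightarrow> 'a mpoly" is
  "\<lambda>k p m. real (Suc (count m k)) * p (add_mset k m)"
proof -
  fix k and p :: "'a multiset \<Rightarrow> real"
  assume "finite {m. p m \<noteq> 0}"
  moreover have "{m. real (Suc (count m k)) * p (add_mset k m) \<noteq> 0} \<subseteq> add_mset k -` {m. p m \<noteq> 0}"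
    by auto
  ultimately show "finite {m. real (Suc (count m k)) * p (add_mset k m) \<noteq> 0}"
    by (meson finite_subset finite_vimageI injI add_mset_add_mset_same_iff)
qed

lemma lookup_pdiff:
  "Poly_Mapping.lookup (pdiff k p) m = real (Suc (count m k)) * Poly_Mapping.lookup p (add_mset k m)"
  by transfer simp

lemma pdiff_add: "pdiff k (p + q) = pdiff k p + pdiff k q"
  by (rule poly_mapping_eqI) (simp add: lookup_pdiff lookup_add algebra_simps)

lemma pdiff_single:
  "pdiff k (Poly_Mapping.single m c) = Poly_Mapping.single (m - {#k#}) (real (count m k) * c)"
proof (rule poly_mapping_eqI)
  fix l
  show "Poly_Mapping.lookup (pdiff k (Poly_Mapping.single m c)) l
      = Poly_Mapping.lookup (Poly_Mapping.single (m - {#k#}) (real (count m k) * c)) l"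
  proof (cases "k \<in># m")
    case True
    then obtain m' where "m = add_mset k m'" by (meson multi_member_split)
    then show ?thesis by (simp add: lookup_pdiff lookup_single when_def)
  next
    case False
    then have "m \<noteq> add_mset k l" by auto
    then show ?thesis using False
      by (simp add: lookup_pdiff lookup_single when_def not_in_iff)
  qed
qed

lemma pdiff_mult_single:
  fixes c d :: real and m n :: "'a multiset"
  defines "p \<equiv> Poly_Mapping.single m c" and "q \<equiv> Poly_Mapping.single n d"
  shows "pdiff k (p * q) = pdiff k p * q + p * pdiff k q"
proof -
  have *: "Poly_Mapping.single (m + n - {#k#}) (real (count m k) * (c * d))
      = Poly_Mapping.single (m - {#k#} + n) (real (count m k) * (c * d))"
    by (cases "k \<in># m") (auto simp: not_in_iff dest!: multi_member_split)
  have **: "Poly_Mapping.single (m + n - {#k#}) (real (count n k) * (c * d))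
      = Poly_Mapping.single (m + (n - {#k#})) (real (count n k) * (c * d))"
    by (cases "k \<in># n") (auto simp: not_in_iff dest!: multi_member_split)
  show ?thesis
    by (simp add: p_def q_def mult_single pdiff_single distrib_right single_add * **) (simp add: ac_simps)
qed

interpretation pdiff: derivation "pdiff k"
proof
  fix p q :: "'a mpoly"
  show "pdiff k (p + q) = pdiff k p + pdiff k q" by (rule pdiff_add)
  have zero: "pdiff k 0 = 0" using pdiff_add[of k 0 0] by simp
  have single: "pdiff k (Poly_Mapping.single m c * q)
      = pdiff k (Poly_Mapping.single m c) * q + Poly_Mapping.single m c * pdiff k q" for m c
    by (induction q rule: poly_mapping_single_induct)
      (simp_all add: zero pdiff_mult_single pdiff_add distrib_left)
  show "pdiff k (p * q) = pdiff k p * q + p * pdiff k q"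
    by (induction p rule: poly_mapping_single_induct)
      (simp_all add: zero single pdiff_add distrib_right)
qed

text \<open>This is the sum of \<open>x_k\<close> times \<open>pdiff k\<close> over all
  \<open>k\<close>. On a polynomial counting trees it marks an arbitrary vertex.\<close>

lift_definition euler :: "'a mpoly \<Rightarrow> 'a mpoly" is "\<lambda>p m. real (size m) * p m"
  by (rule finite_subset[rotated]) auto

lemma lookup_euler: "Poly_Mapping.lookup (euler p) m = real (size m) * Poly_Mapping.lookup p m"
  by transfer simp

lemma euler_add: "euler (p + q) = euler p + euler q"
  by (rule poly_mapping_eqI) (simp add: lookup_euler lookup_add algebra_simps)

lemma euler_single: "euler (Poly_Mapping.single m c) = Poly_Mapping.single m (real (size m) * c)"
  by (rule poly_mapping_eqI) (simp add: lookup_euler lookup_single when_def)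

lemma euler_mult_single:
  "euler (Poly_Mapping.single m c * Poly_Mapping.single n d)
   = euler (Poly_Mapping.single m c) * Poly_Mapping.single n d
     + Poly_Mapping.single m c * euler (Poly_Mapping.single n d)"
  by (simp add: mult_single euler_single flip: single_add) (simp add: algebra_simps)

interpretation euler: derivation euler
proof
  fix p q :: "'a mpoly"
  show "euler (p + q) = euler p + euler q" by (rule euler_add)
  have zero: "euler 0 = 0" using euler_add[of 0 0] by simp
  have single: "euler (Poly_Mapping.single m c * q)
      = euler (Poly_Mapping.single m c) * q + Poly_Mapping.single m c * euler q" for m c
    by (induction q rule: poly_mapping_single_induct)
      (simp_all add: zero euler_mult_single euler_add distrib_left)
  show "euler (p * q) = euler p * q + p * euler q"
    by (induction p rule: poly_mapping_single_induct)
      (simp_all add: zero single euler_add distrib_right)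
qed

lemma ord_ge_pdiff: "ord_ge (Suc M) p \<Longrightarrow> ord_ge M (pdiff k p)"
  by (rule ord_geI) (simp add: lookup_pdiff ord_geD)

lemma ord_ge_euler: "ord_ge M p \<Longrightarrow> ord_ge M (euler p)"
  by (rule ord_geI) (simp add: lookup_euler ord_geD)

section \<open>The generating polynomials of bounded height\<close>

definition var :: "nat \<Rightarrow> nat mpoly" where
  "var k = Poly_Mapping.single {#k#} 1"

lemma nonneg_var [simp]: "nonneg (var k)"
  by (simp add: var_def)

lemma ord_ge_var [simp]: "ord_ge 1 (var k)"
  by (simp add: var_def ord_ge_def)

lemma pdiff_var: "pdiff a (var k) = (if k = a then 1 else 0)"
  by (simp add: var_def pdiff_single)

lemma euler_var: "euler (var k) = var k"
  by (simp add: var_def euler_single)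

text \<open>The bound \<open>K\<close> on the degrees keeps this a polynomial; it excludes no tree
  with at most \<open>K\<close> vertices.\<close>

primrec genpoly :: "nat \<Rightarrow> nat \<Rightarrow> nat mpoly" where
  "genpoly K 0 = 0"
| "genpoly K (Suc h) = (\<Sum>k\<le>K. var k * genpoly K h ^ k)"

text \<open>With \<phi>(z) = \<Sum> x_k z^k over k \<le> K, the recursion applies \<phi> to
  \<open>genpoly K h\<close>; \<open>offspring'\<close> and \<open>offspring''\<close> are the first
  two derivatives of \<phi>.\<close>

definition offspring' :: "nat \<Rightarrow> nat mpoly \<Rightarrow> nat mpoly" where
  "offspring' K z = (\<Sum>k\<le>K. var k * (of_nat k * z ^ (k - 1)))"

definition offspring'' :: "nat \<Rightarrow> nat mpoly \<Rightarrow> nat mpoly" where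
  "offspring'' K z = (\<Sum>k\<le>K. var k * (of_nat k * (of_nat (k - 1) * z ^ (k - 2))))"

lemma nonneg_genpoly: "nonneg (genpoly K h)"
  by (induction h) (simp_all add: nonneg_intros)

lemma nonneg_offspring': "nonneg z \<Longrightarrow> nonneg (offspring' K z)"
  by (simp add: offspring'_def nonneg_intros)

lemma nonneg_offspring'': "nonneg z \<Longrightarrow> nonneg (offspring'' K z)"
  by (simp add: offspring''_def nonneg_intros)

lemma ord_ge_offspring': "ord_ge 1 (offspring' K z)"
  unfolding offspring'_def by (intro ord_ge_sum ord_ge_mult_right ord_ge_var)

lemma sum_pdiff_var: "a \<le> K \<Longrightarrow> (\<Sum>k\<le>K. pdiff a (var k) * f k) = f a"
  by (simp add: pdiff_var if_distrib[of "\<lambda>x. x * _"] cong: if_cong)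

text \<open>Chain rule. Tree-wise, the marked vertex is the root, with \<open>a\<close> subtrees, or
  it lies in one of the subtrees of the root.\<close>

lemma pdiff_genpoly_Suc:
  assumes "a \<le> K"
  shows "pdiff a (genpoly K (Suc h))
    = genpoly K h ^ a + offspring' K (genpoly K h) * pdiff a (genpoly K h)"
proof -
  have "pdiff a (genpoly K (Suc h)) = (\<Sum>k\<le>K. pdiff a (var k) * genpoly K h ^ k)
      + offspring' K (genpoly K h) * pdiff a (genpoly K h)"
    by (simp add: pdiff.sum pdiff.mult pdiff.power sum.distrib offspring'_def sum_distrib_left ac_simps)
  then show ?thesis using assms by (simp add: sum_pdiff_var)
qed

lemma pdiff_offspring':
  assumes "b \<le> K"
  shows "pdiff b (offspring' K z) = of_nat b * z ^ (b - 1) + offspring'' K z * pdiff b z"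
proof -
  have "pdiff b (offspring' K z) = (\<Sum>k\<le>K. pdiff b (var k) * (of_nat k * z ^ (k - 1)))
      + offspring'' K z * pdiff b z"
    by (simp add: offspring'_def offspring''_def pdiff.sum pdiff.mult pdiff.power sum.distrib
      sum_distrib_left distrib_left ac_simps numeral_2_eq_2)
  then show ?thesis using assms by (simp add: sum_pdiff_var)
qed

text \<open>
  Together with \<open>offspring'' K T * (pdiff a T * pdiff b T)\<close>, this is the inhomogeneity of the linear
  recursion for the mixed second derivatives.
\<close>

definition mixed :: "nat \<Rightarrow> nat \<Rightarrow> nat mpoly \<Rightarrow> nat mpoly" where
  "mixed a b T = of_nat a * T ^ (a - 1) * pdiff b T + of_nat b * T ^ (b - 1) * pdiff a T"

text \<open>Tree-wise, of two marked vertices one is the root (\<open>mixed\<close>), or they lie in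
  different subtrees of the root (\<open>offspring''\<close>), or in the same one
  (\<open>offspring'\<close>).\<close>

lemma pdiff_pdiff_genpoly_Suc:
  fixes K h :: nat
  assumes "a \<le> K" "b \<le> K"
  defines "T \<equiv> genpoly K h"
  shows "pdiff b (pdiff a (genpoly K (Suc h)))
    = mixed a b T + offspring'' K T * (pdiff a T * pdiff b T) + offspring' K T * pdiff b (pdiff a T)"
  using assms
  by (simp only: pdiff_genpoly_Suc T_def pdiff.add pdiff.mult pdiff_offspring' pdiff.power mixed_def)
    (simp add: algebra_simps)

lemma euler_genpoly_Suc:
  "euler (genpoly K (Suc h))
    = genpoly K (Suc h) + offspring' K (genpoly K h) * euler (genpoly K h)"
  by (simp add: euler.sum euler.mult euler.power euler_var sum.distrib offspring'_def
    sum_distrib_left ac_simps)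

section \<open>Monotonicity in the height bound and stabilization\<close>

lemma nonneg_genpoly_Suc_diff: "nonneg (genpoly K (Suc h) - genpoly K h)"
proof (induction h)
  case (Suc h)
  have "genpoly K (Suc (Suc h)) - genpoly K (Suc h)
      = (\<Sum>k\<le>K. var k * (genpoly K (Suc h) ^ k - genpoly K h ^ k))"
    by (simp add: sum_subtractf right_diff_distrib)
  moreover have "nonneg \<dots>"
    using nonneg_diff_power[OF nonneg_genpoly Suc] by (auto intro!: nonneg_sum nonneg_mult)
  ultimately show ?case by metis
qed (simp add: nonneg_intros nonneg_genpoly)

lemma nonneg_genpoly_diff: "i \<le> j \<Longrightarrow> nonneg (genpoly K j - genpoly K i)"
proof (induction j rule: dec_induct)
  case (step j)
  have "genpoly K (Suc j) - genpoly K i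
      = (genpoly K (Suc j) - genpoly K j) + (genpoly K j - genpoly K i)" by simp
  then show ?case using nonneg_add[OF nonneg_genpoly_Suc_diff step.IH] by metis
qed simp

text \<open>Each step of the recursion multiplies by a variable and so gains one order. Tree-wise, a
  tree of height \<open>h\<close> has at least \<open>h + 1\<close> vertices.\<close>

lemma ord_ge_genpoly_Suc_diff: "ord_ge (Suc h) (genpoly K (Suc h) - genpoly K h)"
proof (induction h)
  case 0
  have "ord_ge 1 (genpoly K (Suc 0))"
    unfolding genpoly.simps by (intro ord_ge_sum ord_ge_mult_right ord_ge_var)
  then show ?case by simp
next
  case (Suc h)
  have "genpoly K (Suc (Suc h)) - genpoly K (Suc h)
      = (\<Sum>k\<le>K. var k * (genpoly K (Suc h) ^ k - genpoly K h ^ k))"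
    by (simp add: sum_subtractf right_diff_distrib)
  moreover have "ord_ge (1 + Suc h) \<dots>"
    by (intro ord_ge_sum ord_ge_mult ord_ge_var ord_ge_diff_power Suc)
  ultimately show ?case by (metis plus_1_eq_Suc)
qed

lemma ord_ge_genpoly_diff: "i \<le> j \<Longrightarrow> ord_ge (Suc i) (genpoly K j - genpoly K i)"
proof (induction j rule: dec_induct)
  case (step j)
  have "genpoly K (Suc j) - genpoly K i
      = (genpoly K (Suc j) - genpoly K j) + (genpoly K j - genpoly K i)" by simp
  moreover have "ord_ge (Suc i) (genpoly K (Suc j) - genpoly K j)"
    using ord_ge_genpoly_Suc_diff step.hyps by (meson Suc_le_mono ord_ge_mono)
  ultimately show ?case using step.IH by (metis ord_ge_add)
qed simp

text \<open>
  Tree-wise, \<open>pdiff a\<close> marks a vertex with \<open>a\<close> children; \<open>j\<close> bounds the height below the marked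
  vertex and \<open>chain\<close> collects what hangs off the path from the root to it.
\<close>

definition chain :: "nat \<Rightarrow> nat \<Rightarrow> nat \<Rightarrow> nat mpoly" where
  "chain K h j = (\<Prod>i\<in>{j<..<h}. offspring' K (genpoly K i))"

lemma nonneg_chain: "nonneg (chain K h j)"
  unfolding chain_def by (intro nonneg_prod nonneg_offspring' nonneg_genpoly)

text \<open>Unrolls the linear recursion of \<open>pdiff_genpoly_Suc\<close>. The nonnegative
  weights \<open>chain K h j\<close> are the same for all \<open>a\<close>; only the exponent
  depends on the marked degree.\<close>

lemma pdiff_genpoly_eq_chain:
  assumes "a \<le> K"
  shows "pdiff a (genpoly K h) = (\<Sum>j<h. chain K h j * genpoly K j ^ a)"
proof (induction h)
  case (Suc h)
  have "chain K (Suc h) j = offspring' K (genpoly K h) * chain K h j" if "j < h" for j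
  proof -
    have "{j<..<Suc h} = insert h {j<..<h}" using that by auto
    then show ?thesis by (simp add: chain_def)
  qed
  moreover have "chain K (Suc h) h = 1"
  proof -
    have "{h<..<Suc h} = {}" by auto
    then show ?thesis by (simp add: chain_def)
  qed
  ultimately show ?case
    using assms
    by (simp del: genpoly.simps add: pdiff_genpoly_Suc Suc sum_distrib_left mult.assoc)
qed simp

text \<open>A product of two first derivatives is a double sum with weights symmetric in
  \<open>i\<close> and \<open>j\<close>. Adding to each summand its mirror image turns twice the
  difference into a nonnegative combination of the expressions in
  \<open>nonneg_balance_power\<close>.\<close>

lemma pdiff_product_balance:
  fixes K h :: nat
  assumes "Suc (b + l) \<le> K"
  defines "T \<equiv> genpoly K h"
  shows "nonneg (pdiff (Suc (b + l)) T * pdiff b T - pdiff (b + l) T * pdiff (Suc b) T)"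
    (is "nonneg ?d")
proof -
  let ?G = "genpoly K" and ?c = "chain K h"
  define e where "e i j = ?G i ^ Suc (b + l) * ?G j ^ b + ?G j ^ Suc (b + l) * ?G i ^ b
      - (?G i ^ (b + l) * ?G j ^ Suc b + ?G j ^ (b + l) * ?G i ^ Suc b)" for i j
  have prod: "pdiff p T * pdiff q T = (\<Sum>i<h. \<Sum>j<h. ?c i * ?c j * (?G i ^ p * ?G j ^ q))"
    if "p \<le> K" "q \<le> K" for p q
    unfolding T_def pdiff_genpoly_eq_chain[OF that(1)] pdiff_genpoly_eq_chain[OF that(2)]
      sum_product by (simp add: ac_simps)
  have prod': "pdiff p T * pdiff q T = (\<Sum>i<h. \<Sum>j<h. ?c i * ?c j * (?G j ^ p * ?G i ^ q))"
    if "p \<le> K" "q \<le> K" for p q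
    unfolding prod[OF that] by (subst sum.swap) (simp add: ac_simps)
  have double: "pdiff p T * pdiff q T + pdiff p T * pdiff q T
      = (\<Sum>i<h. \<Sum>j<h. ?c i * ?c j * (?G i ^ p * ?G j ^ q + ?G j ^ p * ?G i ^ q))"
    if "p \<le> K" "q \<le> K" for p q
    by (subst (2) prod'[OF that], subst prod[OF that]) (simp only: sum.distrib distrib_left)
  have le: "b \<le> K" "b + l \<le> K" "Suc b \<le> K" using assms(1) by auto
  have "?d + ?d = (pdiff (Suc (b + l)) T * pdiff b T + pdiff (Suc (b + l)) T * pdiff b T)
      - (pdiff (b + l) T * pdiff (Suc b) T + pdiff (b + l) T * pdiff (Suc b) T)"
    by (simp add: algebra_simps)
  also have "\<dots> = (\<Sum>i<h. \<Sum>j<h. ?c i * ?c j * e i j)"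
    unfolding double[OF assms(1) le(1)] double[OF le(2,3)] e_def
    by (simp only: sum_subtractf right_diff_distrib)
  also have "nonneg \<dots>"
  proof (intro nonneg_sum nonneg_mult nonneg_chain)
    fix i j
    show "nonneg (e i j)"
    proof (cases "i \<le> j")
      \<comment> \<open>\<open>e i j\<close> is symmetric in \<open>i\<close> and \<open>j\<close>,
        so in either case the polynomial with the larger index can play the part of
        \<open>z\<close>.\<close>
      case True
      from nonneg_balance_power[OF nonneg_genpoly nonneg_genpoly_diff[OF True], where b = b and l = l]
      show ?thesis unfolding e_def by (simp only: add.commute)
    next
      case False
      then have "j \<le> i" by simp
      from nonneg_balance_power[OF nonneg_genpoly nonneg_genpoly_diff[OF this], where b = b and l = l]
      show ?thesis unfolding e_def by (simp only: add.commute)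
    qed
  qed
  finally have "nonneg (?d + ?d)" .
  then show ?thesis by (rule nonneg_half)
qed

text \<open>One marked vertex is the root, so only the other is expanded into a sum over
  \<open>j\<close>. As \<open>j < h\<close>, \<open>nonneg_balance_deriv\<close> applies with
  \<open>z = T\<close> and \<open>y = genpoly K j\<close>.\<close>

lemma mixed_balance:
  fixes K h :: nat
  assumes "Suc (b + l) \<le> K"
  defines "T \<equiv> genpoly K h"
  shows "nonneg (mixed (Suc (b + l)) b T - mixed (b + l) (Suc b) T)"
proof -
  let ?G = "genpoly K" and ?c = "chain K h"
  define e where "e y = of_nat (Suc (b + l)) * T ^ (b + l) * y ^ b
      + of_nat b * T ^ (b - 1) * y ^ Suc (b + l)
      - (of_nat (b + l) * T ^ (b + l - 1) * y ^ Suc b + of_nat (Suc b) * T ^ b * y ^ (b + l))" for y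
  have mixed: "mixed p q T
      = (\<Sum>j<h. ?c j * (of_nat p * T ^ (p - 1) * ?G j ^ q + of_nat q * T ^ (q - 1) * ?G j ^ p))"
    if "p \<le> K" "q \<le> K" for p q
    unfolding mixed_def
    by (simp only: T_def pdiff_genpoly_eq_chain[OF that(1)] pdiff_genpoly_eq_chain[OF that(2)]
      sum_distrib_left sum.distrib[symmetric]) (simp add: algebra_simps)
  have le: "b \<le> K" "b + l \<le> K" "Suc b \<le> K" using assms(1) by auto
  have "mixed (Suc (b + l)) b T - mixed (b + l) (Suc b) T = (\<Sum>j<h. ?c j * e (?G j))"
    unfolding mixed[OF assms(1) le(1)] mixed[OF le(2,3)] e_def
    by (simp only: sum_subtractf[symmetric] right_diff_distrib[symmetric] diff_Suc_1)
  also have "nonneg \<dots>"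
  proof (intro nonneg_sum nonneg_mult nonneg_chain)
    fix j assume "j \<in> {..<h}"
    then show "nonneg (e (?G j))"
      unfolding e_def T_def
      by (intro nonneg_balance_deriv nonneg_genpoly nonneg_genpoly_diff) simp
  qed
  finally show ?thesis .
qed

text \<open>The degrees are written \<open>Suc (b + l)\<close> and \<open>b\<close> so that the
  first is the larger. By induction on \<open>h\<close>, each of the three positions of the marked
  vertices contributes a nonnegative difference.\<close>

lemma pdiff_pdiff_balance:
  assumes "Suc (b + l) \<le> K"
  shows "nonneg (pdiff b (pdiff (Suc (b + l)) (genpoly K h))
                 - pdiff (Suc b) (pdiff (b + l) (genpoly K h)))"
proof (induction h)
  case (Suc h)
  let ?T = "genpoly K h"
  have le: "b \<le> K" "b + l \<le> K" "Suc b \<le> K" using assms by auto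
  have "pdiff b (pdiff (Suc (b + l)) (genpoly K (Suc h)))
        - pdiff (Suc b) (pdiff (b + l) (genpoly K (Suc h)))
      = (mixed (Suc (b + l)) b ?T - mixed (b + l) (Suc b) ?T)
        + offspring'' K ?T * (pdiff (Suc (b + l)) ?T * pdiff b ?T - pdiff (b + l) ?T * pdiff (Suc b) ?T)
        + offspring' K ?T * (pdiff b (pdiff (Suc (b + l)) ?T) - pdiff (Suc b) (pdiff (b + l) ?T))"
    unfolding pdiff_pdiff_genpoly_Suc[OF assms le(1)] pdiff_pdiff_genpoly_Suc[OF le(2,3)]
    by (simp only: right_diff_distrib) (simp only: diff_conv_add_uminus minus_add_distrib ac_simps)
  also have "nonneg \<dots>"
    by (intro nonneg_add nonneg_mult nonneg_offspring' nonneg_offspring'' nonneg_genpoly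
      mixed_balance pdiff_product_balance assms Suc)
  finally show ?case .
qed simp

section \<open>Congruences in the limit of unbounded height\<close>

text \<open>
  Modulo monomials of large degree, \<open>genpoly K h\<close> is the fixed point \<open>T\<close> counting all trees, and
  differentiating the fixed point equation gives \<open>pdiff a T = T ^ a * pdiff 0 T\<close>.
\<close>

lemma ord_ge_pdiff_fixpoint:
  fixes K h :: nat
  assumes "a \<le> K"
  defines "T \<equiv> genpoly K h"
  shows "ord_ge h (pdiff a T - (T ^ a + offspring' K T * pdiff a T))"
proof -
  have "ord_ge h (pdiff a (T - genpoly K (Suc h)))"
    using ord_ge_genpoly_Suc_diff[of h K] unfolding T_def
    by (intro ord_ge_pdiff) (metis diff_zero minus_diff_eq ord_ge_0 ord_ge_diff diff_0)
  then show ?thesis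
    by (simp only: pdiff.diff pdiff_genpoly_Suc[OF assms(1)] T_def)
qed

text \<open>Modulo degree \<open>h\<close>, both \<open>pdiff a T\<close> and
  \<open>T ^ a * pdiff 0 T\<close> solve \<open>p = T ^ a + offspring' K T * p\<close>, and the
  solution is unique because \<open>offspring' K T\<close> has no constant term.\<close>

lemma ord_ge_pdiff_genpoly:
  fixes K h :: nat
  assumes "a \<le> K"
  defines "T \<equiv> genpoly K h"
  shows "ord_ge h (pdiff a T - T ^ a * pdiff 0 T)"
proof (rule ord_ge_of_fixpoint[OF ord_ge_offspring'])
  let ?r = "\<lambda>a. pdiff a T - (T ^ a + offspring' K T * pdiff a T)"
  have "ord_ge h (?r a - T ^ a * ?r 0)"
    using assms(1) unfolding T_def
    by (intro ord_ge_diff[OF ord_ge_pdiff_fixpoint ord_ge_mult_left[OF ord_ge_pdiff_fixpoint]]) simp_all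
  also have "?r a - T ^ a * ?r 0 = pdiff a T - T ^ a * pdiff 0 T
      - offspring' K T * (pdiff a T - T ^ a * pdiff 0 T)"
    by (simp add: algebra_simps)
  finally show "ord_ge h (pdiff a T - T ^ a * pdiff 0 T
      - offspring' K T * (pdiff a T - T ^ a * pdiff 0 T))" .
qed

lemma ord_ge_mixed:
  fixes K h :: nat
  assumes "a \<le> K" "b \<le> K"
  defines "T \<equiv> genpoly K h"
  shows "ord_ge h (mixed a b T - of_nat (a + b) * T ^ (a + b - 1) * pdiff 0 T)"
proof -
  let ?r = "\<lambda>a. pdiff a T - T ^ a * pdiff 0 T"
  \<comment> \<open>For \<open>p = 0\<close> the truncated exponents may differ, but the factor
    \<open>of_nat p\<close> vanishes.\<close>
  have power: "of_nat p * T ^ (p - 1) * T ^ q = of_nat p * T ^ (p + q - 1)" for p q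
    by (cases p) (simp_all add: power_add)
  have "of_nat a * T ^ (a - 1) * ?r b + of_nat b * T ^ (b - 1) * ?r a
      = mixed a b T - (of_nat a * T ^ (a - 1) * T ^ b * pdiff 0 T
          + of_nat b * T ^ (b - 1) * T ^ a * pdiff 0 T)"
    unfolding mixed_def by (simp add: algebra_simps)
  also have "\<dots> = mixed a b T - of_nat (a + b) * T ^ (a + b - 1) * pdiff 0 T"
    unfolding power by (simp add: algebra_simps)
  finally show ?thesis
    using assms
    by (metis (no_types, lifting) T_def ord_ge_add ord_ge_mult_left ord_ge_pdiff_genpoly)
qed

lemma ord_ge_pdiff_product:
  fixes K h :: nat
  assumes "a \<le> K" "b \<le> K"
  defines "T \<equiv> genpoly K h"
  shows "ord_ge h (pdiff a T * pdiff b T - T ^ (a + b) * pdiff 0 T ^ 2)"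
proof -
  let ?r = "\<lambda>a. pdiff a T - T ^ a * pdiff 0 T"
  have "ord_ge h (?r a * pdiff b T + T ^ a * pdiff 0 T * ?r b)"
    using assms unfolding T_def
    by (intro ord_ge_add ord_ge_mult_left ord_ge_mult_right ord_ge_pdiff_genpoly)
  then show ?thesis by (simp add: algebra_simps power_add power2_eq_square)
qed

text \<open>By \<open>ord_ge_mixed\<close> and \<open>ord_ge_pdiff_product\<close> the inhomogeneity
  of the recursion depends on \<open>a + b\<close> only, so the difference solves the homogeneous
  equation modulo degree \<open>h\<close>. This matches the known number (n - 1)! / \<Prod> m_k! of
  plane trees with n vertices, m_k of them with k children.\<close>

lemma ord_ge_pdiff_pdiff_diff:
  assumes "a \<le> K" "b \<le> K" "c \<le> K" "d \<le> K" "a + b = c + d"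
  shows "ord_ge h (pdiff b (pdiff a (genpoly K (Suc h))) - pdiff d (pdiff c (genpoly K (Suc h))))"
proof -
  define T where "T = genpoly K (Suc h)"
  let ?V = "\<lambda>a b. pdiff b (pdiff a T)"
  let ?q = "\<lambda>a b. mixed a b T + offspring'' K T * (pdiff a T * pdiff b T)"
  let ?q' = "\<lambda>s. of_nat s * T ^ (s - 1) * pdiff 0 T + offspring'' K T * (T ^ s * pdiff 0 T ^ 2)"
  have V: "ord_ge h (?V a b - offspring' K T * ?V a b - ?q' (a + b))" if "a \<le> K" "b \<le> K" for a b
  proof -
    \<comment> \<open>Consecutive iterates agree to order \<open>h + 2\<close>; two derivatives
      leave order \<open>h\<close>.\<close>
    have "ord_ge h (?V a b - pdiff b (pdiff a (genpoly K (Suc (Suc h)))))"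
      unfolding pdiff.diff[symmetric] T_def
      by (intro ord_ge_pdiff)
        (metis ord_ge_genpoly_Suc_diff diff_0 minus_diff_eq ord_ge_0 ord_ge_diff)
    moreover have "ord_ge h (mixed a b T - of_nat (a + b) * T ^ (a + b - 1) * pdiff 0 T)"
      unfolding T_def by (rule ord_ge_mono[OF ord_ge_mixed]) (use that in auto)
    moreover have "ord_ge h (offspring'' K T * (pdiff a T * pdiff b T - T ^ (a + b) * pdiff 0 T ^ 2))"
      unfolding T_def by (intro ord_ge_mult_left ord_ge_mono[OF ord_ge_pdiff_product]) (use that in auto)
    ultimately have "ord_ge h ((?V a b - pdiff b (pdiff a (genpoly K (Suc (Suc h)))))
        + (mixed a b T - of_nat (a + b) * T ^ (a + b - 1) * pdiff 0 T)
        + offspring'' K T * (pdiff a T * pdiff b T - T ^ (a + b) * pdiff 0 T ^ 2))"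
      by (intro ord_ge_add)
    moreover have "(v - (x + o1 * y + d * v)) + (x - x') + o1 * (y - y') = v - d * v - (x' + o1 * y')"
      for v x x' y y' d o1 :: "nat mpoly"
      by (simp add: algebra_simps)
    ultimately show ?thesis
      unfolding pdiff_pdiff_genpoly_Suc[OF that, of "Suc h", folded T_def] by (simp only:)
  qed
  have "ord_ge h ((?V a b - offspring' K T * ?V a b - ?q' (a + b))
      - (?V c d - offspring' K T * ?V c d - ?q' (a + b)))"
    using ord_ge_diff[OF V[OF assms(1,2)] V[OF assms(3,4)]] assms(5) by simp
  moreover have "(v - e * v - q) - (w - e * w - q) = v - w - e * (v - w)" for v w e q :: "nat mpoly"
    by (simp add: algebra_simps)
  ultimately have "ord_ge h (?V a b - ?V c d - offspring' K T * (?V a b - ?V c d))"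
    by (simp only:)
  then show ?thesis
    unfolding T_def by (rule ord_ge_of_fixpoint[OF ord_ge_offspring'])
qed

text \<open>Both obey the same linear recursion, with inhomogeneities
  \<open>genpoly K (Suc h)\<close> and \<open>genpoly K h\<close>. Tree-wise, deleting a marked
  vertex of degree 1 and marking its child cannot increase the height.\<close>

lemma pdiff_1_le_euler:
  assumes "1 \<le> K"
  shows "nonneg (euler (genpoly K h) - pdiff 1 (genpoly K h))"
proof (induction h)
  case (Suc h)
  have "euler (genpoly K (Suc h)) - pdiff 1 (genpoly K (Suc h)) = (genpoly K (Suc h) - genpoly K h)
      + offspring' K (genpoly K h) * (euler (genpoly K h) - pdiff 1 (genpoly K h))"
    unfolding euler_genpoly_Suc pdiff_genpoly_Suc[OF assms]
    by (simp del: genpoly.simps add: algebra_simps)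
  also have "nonneg \<dots>"
    by (intro nonneg_add nonneg_mult nonneg_offspring' nonneg_genpoly nonneg_genpoly_Suc_diff Suc)
  finally show ?case .
qed simp

text \<open>The two inhomogeneities agree modulo degree \<open>h\<close>. Tree-wise, the deletion of
  a marked vertex of degree 1 is a bijection once heights are unbounded.\<close>

lemma ord_ge_euler_pdiff_1:
  assumes "1 \<le> K"
  shows "ord_ge h (euler (genpoly K h) - pdiff 1 (genpoly K h))"
proof (rule ord_ge_of_fixpoint[OF ord_ge_offspring'])
  let ?T = "genpoly K h" and ?S = "genpoly K (Suc h)"
  have S: "ord_ge (Suc h) (?S - ?T)" by (rule ord_ge_genpoly_Suc_diff)
  then have "ord_ge h (?S - ?T)" by (rule ord_ge_mono) simp
  then have "ord_ge h ((?S - ?T) - (euler (?S - ?T) - pdiff 1 (?S - ?T)))"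
    by (intro ord_ge_diff[OF _ ord_ge_diff[OF ord_ge_euler ord_ge_pdiff[OF S]]])
  also have "(?S - ?T) - (euler (?S - ?T) - pdiff 1 (?S - ?T))
      = euler ?T - pdiff 1 ?T - offspring' K ?T * (euler ?T - pdiff 1 ?T)"
    unfolding euler.diff pdiff.diff euler_genpoly_Suc pdiff_genpoly_Suc[OF assms]
    by (simp del: genpoly.simps add: algebra_simps)
  finally show "ord_ge h (euler ?T - pdiff 1 ?T - offspring' K ?T * (euler ?T - pdiff 1 ?T))" .
qed

section \<open>Comparison of degree profiles\<close>

text \<open>
  The value is the proportion of trees of height less than \<open>h\<close> among the plane trees whose multiset
  of degrees is \<open>m\<close>, as a tree with \<open>size m\<close> vertices has height less than \<open>size m\<close>; it is 0 if
  there are no such trees.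
\<close>

definition ratio :: "nat \<Rightarrow> nat \<Rightarrow> nat multiset \<Rightarrow> real" where
  "ratio K h m = Poly_Mapping.lookup (genpoly K h) m / Poly_Mapping.lookup (genpoly K (size m)) m"

lemma lookup_genpoly_nonneg: "0 \<le> Poly_Mapping.lookup (genpoly K h) m"
  using nonneg_genpoly[of K h] by (simp add: nonneg_def)

lemma lookup_genpoly_stable:
  "size m \<le> h \<Longrightarrow> Poly_Mapping.lookup (genpoly K h) m = Poly_Mapping.lookup (genpoly K (size m)) m"
  by (rule ord_ge_diffD[OF ord_ge_genpoly_diff]) simp_all

text \<open>\<open>c\<close> and \<open>d\<close> will be the multiplicities produced by
  differentiation, which cancel in the quotients. By \<open>c * X = d * Y\<close> the denominators
  vanish together, so division by 0 is consistent.\<close>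

lemma divide_le_divide_scaled:
  fixes c d x y X Y :: real
  assumes "0 < c" "0 < d" "c * x \<le> d * y" "c * X = d * Y" "0 \<le> X"
  shows "x / X \<le> y / Y"
proof -
  have "x / X = (c * x) / (c * X)" using assms(1) by simp
  also have "\<dots> \<le> (d * y) / (c * X)" using assms by (intro divide_right_mono mult_nonneg_nonneg) simp_all
  also have "\<dots> = y / Y" unfolding assms(4) using assms(2) by simp
  finally show ?thesis .
qed

lemma lookup_pdiff_pdiff:
  "Poly_Mapping.lookup (pdiff b (pdiff a p)) m
    = real (Suc (count m b) * Suc (count (add_mset b m) a)) * Poly_Mapping.lookup p (add_mset a (add_mset b m))"
  unfolding lookup_pdiff of_nat_mult by (simp only: mult.assoc)

lemma ratio_balance:
  assumes "Suc (b + l) \<le> K"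
  shows "ratio K h (add_mset (b + l) (add_mset (Suc b) m)) \<le> ratio K h (add_mset (Suc (b + l)) (add_mset b m))"
proof -
  let ?N = "Suc (Suc (size m))"
  let ?c = "\<lambda>a b. real (Suc (count m b) * Suc (count (add_mset b m) a))"
  have "?c (b + l) (Suc b) * Poly_Mapping.lookup (genpoly K h) (add_mset (b + l) (add_mset (Suc b) m))
      \<le> ?c (Suc (b + l)) b * Poly_Mapping.lookup (genpoly K h) (add_mset (Suc (b + l)) (add_mset b m))"
    using pdiff_pdiff_balance[OF assms, of h]
    unfolding nonneg_def lookup_minus lookup_pdiff_pdiff by (simp del: of_nat_mult)
  \<comment> \<open>\<open>?N\<close> is the number of vertices of both profiles. The second
    derivatives then agree in degrees up to \<open>size m\<close>, just enough for the coefficients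
    of \<open>m\<close>.\<close>
  moreover have "?c (b + l) (Suc b) * Poly_Mapping.lookup (genpoly K ?N) (add_mset (b + l) (add_mset (Suc b) m))
      = ?c (Suc (b + l)) b * Poly_Mapping.lookup (genpoly K ?N) (add_mset (Suc (b + l)) (add_mset b m))"
    unfolding lookup_pdiff_pdiff[symmetric]
    by (rule ord_ge_diffD[OF ord_ge_pdiff_pdiff_diff]) (use assms in auto)
  ultimately show ?thesis
    unfolding ratio_def size_add_mset
    by (rule divide_le_divide_scaled[rotated 2]) (simp_all add: lookup_genpoly_nonneg del: of_nat_mult genpoly.simps)
qed

lemma ratio_add_1:
  assumes "1 \<le> K" "m \<noteq> {#}"
  shows "ratio K h (add_mset 1 m) \<le> ratio K h m"
proof -
  let ?N = "Suc (size m)"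
  have "real (Suc (count m 1)) * Poly_Mapping.lookup (genpoly K h) (add_mset 1 m)
      \<le> real (size m) * Poly_Mapping.lookup (genpoly K h) m"
    using pdiff_1_le_euler[OF assms(1), of h]
    unfolding nonneg_def lookup_minus lookup_pdiff lookup_euler by simp
  moreover have "real (Suc (count m 1)) * Poly_Mapping.lookup (genpoly K ?N) (add_mset 1 m)
      = real (size m) * Poly_Mapping.lookup (genpoly K ?N) m"
    unfolding lookup_pdiff[symmetric] lookup_euler[symmetric]
    by (rule ord_ge_diffD[OF ord_ge_euler_pdiff_1[OF assms(1)], symmetric]) simp
  moreover have "Poly_Mapping.lookup (genpoly K ?N) m = Poly_Mapping.lookup (genpoly K (size m)) m"
    by (rule lookup_genpoly_stable) simp
  ultimately show ?thesis
    unfolding ratio_def size_add_mset using assms(2)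
    by (intro divide_le_divide_scaled[of "real (Suc (count m 1))" "real (size m)"])
      (simp_all add: lookup_genpoly_nonneg nonempty_has_size[symmetric] del: genpoly.simps)
qed

text \<open>The degrees of a binary tree with \<open>n\<close> vertices, for odd \<open>n\<close> only.\<close>

definition binary_profile :: "nat \<Rightarrow> nat multiset" where
  "binary_profile n = replicate_mset (Suc (n div 2)) 0 + replicate_mset (n div 2) 2"

text \<open>Counting edges gives one more leaf than vertices of degree 2, so in odd size the number
  of entries 1 is even, hence 0.\<close>

lemma eq_binary_profile:
  assumes "set_mset m \<subseteq> {0, 1, 2}" "sum_mset m + 1 = size m" "odd (size m)" "count m 1 \<le> 1"
  shows "m = binary_profile (size m)"
proof -
  have m: "m = replicate_mset (count m 0) 0 + replicate_mset (count m 1) 1 + replicate_mset (count m 2) 2"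
    (is "m = ?r")
  proof (rule multiset_eqI)
    fix k
    have "k \<in> {0, 1, 2} \<or> count m k = 0" using assms(1) by (auto simp: count_eq_zero_iff)
    then show "count m k = count ?r k" by auto
  qed
  have size: "size m = count m 0 + count m 1 + count m 2"
    by (subst m) simp
  have sum: "sum_mset m = count m 1 + 2 * count m 2"
    by (subst m) simp
  have c0: "count m 0 = Suc (count m 2)" using assms(2) unfolding size sum by simp
  have "count m 1 \<noteq> 1"
  proof
    assume "count m 1 = 1"
    then have "size m = 2 * Suc (count m 2)" unfolding size c0 by simp
    then show False using assms(3) by simp
  qed
  then have c1: "count m 1 = 0" using assms(4) by simp
  have "size m = Suc (2 * count m 2)" unfolding size c0 c1 by simp
  then have "size m div 2 = count m 2" by simp
  then have "?r = binary_profile (size m)" by (simp add: binary_profile_def c0 c1[simplified])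
  with m show ?thesis by (rule trans)
qed

text \<open>Each move takes 1 off \<open>2 * count m 0 + count m 1\<close>: a 0 becomes a 1 or a 1
  becomes a 2, while the other entry stays at least 2.\<close>

lemma ratio_binary_profile_le:
  assumes "set_mset m \<subseteq> {..K}" "sum_mset m + 1 = size m" "odd (size m)" "count m 1 \<le> 1"
  shows "ratio K h (binary_profile (size m)) \<le> ratio K h m"
  using assms
proof (induction "2 * count m 0 + count m 1" arbitrary: m rule: less_induct)
  case less
  show ?case
  proof (cases "\<exists>k\<in>#m. 3 \<le> k")
    case False
    then have "set_mset m \<subseteq> {0, 1, 2}" by force
    then have "m = binary_profile (size m)" using less.prems by (intro eq_binary_profile) auto
    then show ?thesis by (intro eq_refl arg_cong[where f = "ratio K h"]) (rule sym)
  next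
    case True
    then obtain k m1 where k: "3 \<le> k" and m1: "m = add_mset k m1"
      by (meson multi_member_split)
    \<comment> \<open>A 1 is used up whenever there is one, so two entries 1 never arise.\<close>
    obtain b where b: "b \<in># m" "b = 1 \<or> b = 0 \<and> 1 \<notin># m"
    proof (cases "1 \<in># m")
      case False
      have "0 \<in># m"
      proof (rule ccontr)
        assume "0 \<notin># m"
        then have "1 \<le> j" if "j \<in># m" for j using that by (cases j) auto
        then have "(\<Sum>j\<in>#m. 1) \<le> (\<Sum>j\<in>#m. j)" by (intro sum_mset_mono) auto
        then show False using less.prems(2) by simp
      qed
      with False show ?thesis by (intro that) auto
    qed (use that in auto)
    have "b \<in># m1" using b k by (auto simp: m1)
    then obtain m2 where m2: "m = add_mset k (add_mset b m2)"
      using m1 by (metis multi_member_split)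
    obtain l where l: "k = Suc (b + l)" "2 \<le> b + l"
      using k b(2) by (intro that[of "k - Suc b"]) auto
    let ?m = "add_mset (b + l) (add_mset (Suc b) m2)"
    have b1: "b = 1 \<and> count m2 1 = 0 \<or> b = 0 \<and> count m2 1 = 0"
      using b(2) less.prems(4) unfolding m2 l(1) by (auto simp: not_in_iff split: if_splits)
    have "ratio K h (binary_profile (size ?m)) \<le> ratio K h ?m"
    proof (rule less.hyps)
      show "2 * count ?m 0 + count ?m 1 < 2 * count m 0 + count m 1"
        using b1 l by (auto simp: m2)
      show "count ?m 1 \<le> 1"
        using b1 l by auto
    qed (use less.prems l b1 in \<open>auto simp: m2\<close>)
    also have "\<dots> \<le> ratio K h m"
      unfolding m2 l using less.prems(1) l by (intro ratio_balance) (auto simp: m2)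
    finally show ?thesis by (simp add: m2)
  qed
qed

section \<open>Plane trees with a given degree profile\<close>

definition outdeg :: "nat list set \<Rightarrow> nat list \<Rightarrow> nat" where
  "outdeg T v = card {i. v @ [i] \<in> T}"

definition profile :: "nat list set \<Rightarrow> nat multiset" where
  "profile T = (\<Sum>v\<in>T. {#outdeg T v#})"

lemma outdeg_family_tree: "v \<in> family_tree \<xi> \<Longrightarrow> outdeg (family_tree \<xi>) v = \<xi> v"
  by (simp add: outdeg_def snoc_in_family_tree_iff)

lemma size_profile: "size (profile T) = card T"
  unfolding profile_def by (induction T rule: infinite_finite_induct) auto

lemma prod_mset_profile: "(\<Prod>k\<in>#profile T. f k) = (\<Prod>v\<in>T. f (outdeg T v))"
proof -
  have "(\<Prod>k\<in>#(\<Sum>v\<in>A. {#outdeg T v#}). f k) = (\<Prod>v\<in>A. f (outdeg T v))" for A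
    by (induction A rule: infinite_finite_induct) auto
  then show ?thesis by (simp add: profile_def)
qed

text \<open>Inverts the decomposition at the root: \<open>ts\<close> lists the subtrees from left to
  right.\<close>

definition graft :: "nat list set list \<Rightarrow> nat list set" where
  "graft ts = insert [] (\<Union>i<length ts. (#) i ` (ts ! i))"

lemma Nil_in_graft [simp]: "[] \<in> graft ts"
  by (simp add: graft_def)

lemma Cons_in_graft: "i # u \<in> graft ts \<longleftrightarrow> i < length ts \<and> u \<in> ts ! i"
  by (auto simp: graft_def)

lemma nth_graft: "i < length ts \<Longrightarrow> ts ! i = {u. i # u \<in> graft ts}"
  by (simp add: Cons_in_graft)

lemma outdeg_graft_Nil:
  assumes "\<forall>t\<in>set ts. [] \<in> t"
  shows "outdeg (graft ts) [] = length ts"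
proof -
  have "{i. [i] \<in> graft ts} = {..<length ts}"
    using assms by (auto simp: Cons_in_graft)
  then show ?thesis by (simp add: outdeg_def)
qed

lemma graft_inject:
  assumes "\<forall>t\<in>set ts. [] \<in> t" "\<forall>t\<in>set us. [] \<in> t" "graft ts = graft us"
  shows "ts = us"
proof (rule nth_equalityI)
  show len: "length ts = length us"
    using outdeg_graft_Nil[OF assms(1)] outdeg_graft_Nil[OF assms(2)] assms(3) by simp
  show "ts ! i = us ! i" if "i < length ts" for i
    using nth_graft[of i ts] nth_graft[of i us] that len assms(3) by simp
qed

lemma profile_graft:
  assumes "\<forall>t\<in>set ts. [] \<in> t \<and> finite t"
  shows "profile (graft ts) = add_mset (length ts) (\<Sum>t\<leftarrow>ts. profile t)"
proof -
  let ?d = "\<lambda>v. {#outdeg (graft ts) v#}" and ?U = "\<Union>i<length ts. (#) i ` (ts ! i)"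
  have fin: "finite (ts ! i)" if "i < length ts" for i
    using that assms by simp
  have U: "finite ?U" "[] \<notin> ?U" using fin by auto
  have "outdeg (graft ts) (i # u) = outdeg (ts ! i) u" if "i < length ts" for i u
    using that by (simp add: outdeg_def Cons_in_graft)
  then have sub: "(\<Sum>v\<in>(#) i ` (ts ! i). ?d v) = profile (ts ! i)" if "i < length ts" for i
    using that by (simp add: sum.reindex profile_def)
  have "profile (graft ts) = ?d [] + (\<Sum>v\<in>?U. ?d v)"
    using sum.insert[OF U, of ?d] unfolding graft_def[symmetric] profile_def .
  also have "(\<Sum>v\<in>?U. ?d v) = (\<Sum>i<length ts. \<Sum>v\<in>(#) i ` (ts ! i). ?d v)"
    by (rule sum.UNION_disjoint) (use fin in auto)
  also have "\<dots> = (\<Sum>i<length ts. profile (ts ! i))"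
    by (intro sum.cong refl sub) simp
  also have "\<dots> = (\<Sum>t\<leftarrow>ts. profile t)"
    by (simp add: sum_list_sum_nth atLeast0LessThan)
  finally show ?thesis using assms by (simp add: outdeg_graft_Nil)
qed

text \<open>Follows the recursion of \<open>genpoly\<close>; \<open>trees_iff\<close> identifies
  these sets as the finite family trees of height less than \<open>h\<close> with degrees at most
  \<open>K\<close>.\<close>

primrec bounded_trees :: "nat \<Rightarrow> nat \<Rightarrow> nat list set set" where
  "bounded_trees K 0 = {}"
| "bounded_trees K (Suc h) = graft ` {ts. set ts \<subseteq> bounded_trees K h \<and> length ts \<le> K}"

lemma finite_trees: "finite (bounded_trees K h)"
proof (induction h)
  case (Suc h)
  then show ?case unfolding bounded_trees.simps by (intro finite_imageI finite_lists_length_le)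
qed simp

lemma trees_memD: "T \<in> bounded_trees K h \<Longrightarrow> [] \<in> T \<and> finite T"
proof (induction h arbitrary: T)
  case (Suc h)
  then obtain ts where "T = graft ts" "set ts \<subseteq> bounded_trees K h" by auto
  then have "finite (ts ! i)" if "i < length ts" for i
    using that Suc.IH nth_mem by blast
  then show ?case by (auto simp: \<open>T = graft ts\<close> graft_def)
qed simp

lemma profile_trees:
  "T \<in> bounded_trees K h \<Longrightarrow> set_mset (profile T) \<subseteq> {..K} \<and> sum_mset (profile T) + 1 = size (profile T)"
proof (induction h arbitrary: T)
  case (Suc h)
  then obtain ts where T: "T = graft ts" and ts: "set ts \<subseteq> bounded_trees K h" "length ts \<le> K" by auto
  have profile: "profile T = add_mset (length ts) (\<Sum>t\<leftarrow>ts. profile t)"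
    unfolding T using ts by (intro profile_graft) (auto dest: trees_memD)
  have "set_mset (\<Sum>t\<leftarrow>ts. profile t) \<subseteq> {..K}
      \<and> sum_mset (\<Sum>t\<leftarrow>ts. profile t) + length ts = size (\<Sum>t\<leftarrow>ts. profile t)"
    using ts(1)
  proof (induction ts)
    case (Cons t ts)
    then show ?case using Suc.IH[of t] by auto
  qed simp
  then show ?case using ts(2) by (simp add: profile)
qed simp

lemma power_sum_eq_sum_lists:
  fixes f :: "'a \<Rightarrow> 'b::comm_semiring_1"
  assumes "finite A"
  shows "(\<Sum>x\<in>A. f x) ^ k = (\<Sum>xs | set xs \<subseteq> A \<and> length xs = k. \<Prod>x\<leftarrow>xs. f x)"
proof (induction k)
  case 0
  have "{xs. set xs \<subseteq> A \<and> length xs = 0} = {[]}" by auto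
  then show ?case by simp
next
  case (Suc k)
  let ?L = "{xs. set xs \<subseteq> A \<and> length xs = k}"
  have "{xs. set xs \<subseteq> A \<and> length xs = Suc k} = (\<lambda>(x, xs). x # xs) ` (A \<times> ?L)"
    by (force simp: length_Suc_conv image_iff)
  then have "(\<Sum>xs | set xs \<subseteq> A \<and> length xs = Suc k. \<Prod>x\<leftarrow>xs. f x)
      = (\<Sum>(x, xs)\<in>A \<times> ?L. f x * (\<Prod>x\<leftarrow>xs. f x))"
    by (simp add: sum.reindex inj_on_def case_prod_unfold comp_def)
  also have "\<dots> = (\<Sum>x\<in>A. f x) * (\<Sum>xs\<in>?L. \<Prod>x\<leftarrow>xs. f x)"
    by (simp add: sum_product sum.cartesian_product)
  finally show ?case using Suc by simp
qed

text \<open>Expanding \<open>genpoly K h ^ k\<close> over lists gives the ordered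
  \<open>k\<close>-tuples of subtrees, and \<open>var k\<close> records the root. As
  \<open>graft\<close> is injective, no tree is counted twice.\<close>

lemma genpoly_eq_sum_trees: "genpoly K h = (\<Sum>T\<in>bounded_trees K h. Poly_Mapping.single (profile T) 1)"
proof (induction h)
  case (Suc h)
  let ?A = "bounded_trees K h" and ?f = "\<lambda>T. Poly_Mapping.single (profile T) (1::real)"
  let ?L = "\<lambda>k. {ts. set ts \<subseteq> ?A \<and> length ts = k}"
  have inj: "inj_on graft {ts. set ts \<subseteq> ?A \<and> length ts \<le> K}"
    by (intro inj_onI graft_inject) (auto dest: trees_memD)
  have f_graft: "?f (graft ts) = var k * (\<Prod>t\<leftarrow>ts. ?f t)" if "ts \<in> ?L k" for k ts
  proof -
    have "(\<Prod>t\<leftarrow>ts. ?f t) = Poly_Mapping.single (\<Sum>t\<leftarrow>ts. profile t) 1"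
      by (induction ts) (simp_all add: mult_single)
    moreover have "profile (graft ts) = add_mset k (\<Sum>t\<leftarrow>ts. profile t)"
      using that profile_graft[of ts] by (auto dest: trees_memD)
    ultimately show ?thesis by (simp add: var_def mult_single)
  qed
  have "(\<Sum>T\<in>bounded_trees K (Suc h). ?f T) = (\<Sum>ts\<in>(\<Union>k\<le>K. ?L k). ?f (graft ts))"
    unfolding bounded_trees.simps sum.reindex[OF inj] comp_def by (rule sum.cong) auto
  also have "\<dots> = (\<Sum>k\<le>K. \<Sum>ts\<in>?L k. ?f (graft ts))"
    by (rule sum.UNION_disjoint) (auto intro: finite_lists_length_eq finite_trees)
  also have "\<dots> = (\<Sum>k\<le>K. var k * (\<Sum>ts\<in>?L k. \<Prod>t\<leftarrow>ts. ?f t))"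
    by (simp add: f_graft sum_distrib_left)
  also have "\<dots> = genpoly K (Suc h)"
    by (simp add: Suc power_sum_eq_sum_lists finite_trees)
  finally show ?case by simp
qed simp

lemma lookup_genpoly: "Poly_Mapping.lookup (genpoly K h) m = card {T \<in> bounded_trees K h. profile T = m}"
proof -
  have "Poly_Mapping.lookup (genpoly K h) m = (\<Sum>T\<in>bounded_trees K h. if profile T = m then 1 else 0)"
    by (simp add: genpoly_eq_sum_trees lookup_sum lookup_single when_def)
  also have "\<dots> = card {T \<in> bounded_trees K h. profile T = m}"
    by (simp add: finite_trees sum.If_cases Int_def)
  finally show ?thesis .
qed

lemma lookup_genpoly_nonzeroD:
  assumes "Poly_Mapping.lookup (genpoly K h) m \<noteq> 0"
  shows "set_mset m \<subseteq> {..K}" "sum_mset m + 1 = size m"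
proof -
  have "{T \<in> bounded_trees K h. profile T = m} \<noteq> {}"
    using assms unfolding lookup_genpoly by force
  then obtain T where "T \<in> bounded_trees K h" "profile T = m" by blast
  then show "set_mset m \<subseteq> {..K}" "sum_mset m + 1 = size m"
    using profile_trees by blast+
qed

section \<open>Bounded trees as family trees\<close>

lemma Cons_in_family_tree_iff:
  "i # u \<in> family_tree \<xi> \<longleftrightarrow> i < \<xi> [] \<and> u \<in> family_tree (\<lambda>v. \<xi> (i # v))"
proof (induction u rule: rev_induct)
  case Nil
  then show ?case using snoc_in_family_tree_iff[of "[]" i \<xi>] by (simp add: family_tree.root)
next
  case (snoc j u)
  then show ?case using snoc_in_family_tree_iff[of "i # u" j \<xi>] by (auto simp: snoc_in_family_tree_iff)
qed

lemma family_tree_eq_graft: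
  "family_tree \<xi> = graft (map (\<lambda>i. family_tree (\<lambda>v. \<xi> (i # v))) [0..<\<xi> []])"
proof (rule set_eqI)
  fix v
  show "v \<in> family_tree \<xi> \<longleftrightarrow> v \<in> graft (map (\<lambda>i. family_tree (\<lambda>v. \<xi> (i # v))) [0..<\<xi> []])"
    by (cases v) (auto simp: family_tree.root Cons_in_family_tree_iff Cons_in_graft)
qed

lemma trees_iff:
  "T \<in> bounded_trees K h \<longleftrightarrow> (\<exists>\<xi>. T = family_tree \<xi> \<and> finite T \<and> (\<forall>v\<in>T. length v < h \<and> \<xi> v \<le> K))"
proof (induction h arbitrary: T)
  case 0
  have "\<not> (\<forall>v\<in>family_tree \<xi>. length v < 0 \<and> \<xi> v \<le> K)" for \<xi>
    using family_tree.root[of \<xi>] by blast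
  then show ?case unfolding bounded_trees.simps by blast
next
  case (Suc h)
  show ?case
  proof
    assume T: "T \<in> bounded_trees K (Suc h)"
    then obtain ts where ts: "T = graft ts" "set ts \<subseteq> bounded_trees K h" "length ts \<le> K" by auto
    \<comment> \<open>The guard \<open>i < length ts\<close> makes this true for every
      \<open>i\<close>, so that labellings of all subtrees can be chosen at once.\<close>
    have "\<exists>\<xi>. i < length ts \<longrightarrow> ts ! i = family_tree \<xi> \<and> (\<forall>v\<in>ts ! i. length v < h \<and> \<xi> v \<le> K)" for i
    proof (cases "i < length ts")
      case True
      then have "ts ! i \<in> bounded_trees K h" using ts(2) nth_mem by blast
      then show ?thesis unfolding Suc.IH by blast
    qed simp
    then obtain \<Xi> where *: "\<forall>i. i < length ts \<longrightarrow> ts ! i = family_tree (\<Xi> i)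
        \<and> (\<forall>v\<in>ts ! i. length v < h \<and> \<Xi> i v \<le> K)"
      by (elim choice[rule_format, elim_format] exE)
    then have \<Xi>: "ts ! i = family_tree (\<Xi> i)" "\<forall>v\<in>ts ! i. length v < h \<and> \<Xi> i v \<le> K"
      if "i < length ts" for i using that by blast+
    define \<xi> where "\<xi> v = (case v of [] \<Rightarrow> length ts | i # u \<Rightarrow> \<Xi> i u)" for v
    have "map (\<lambda>i. family_tree (\<lambda>v. \<xi> (i # v))) [0..<\<xi> []] = ts"
      by (rule nth_equalityI) (simp_all add: \<xi>_def \<Xi>(1))
    then have graft: "family_tree \<xi> = graft ts"
      using family_tree_eq_graft[of \<xi>] by (rule back_subst[rotated])
    have "length v < Suc h \<and> \<xi> v \<le> K" if "v \<in> graft ts" for v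
      using that \<Xi>(2) ts(3) by (cases v) (auto simp: \<xi>_def Cons_in_graft)
    then show "\<exists>\<xi>. T = family_tree \<xi> \<and> finite T \<and> (\<forall>v\<in>T. length v < Suc h \<and> \<xi> v \<le> K)"
      using graft ts(1) trees_memD[OF T] by blast
  next
    assume "\<exists>\<xi>. T = family_tree \<xi> \<and> finite T \<and> (\<forall>v\<in>T. length v < Suc h \<and> \<xi> v \<le> K)"
    then obtain \<xi> where T: "T = family_tree \<xi>" "finite T" and v: "\<forall>v\<in>T. length v < Suc h \<and> \<xi> v \<le> K"
      by blast
    have "family_tree (\<lambda>v. \<xi> (i # v)) \<in> bounded_trees K h" if i: "i < \<xi> []" for i
    proof -
      let ?S = "family_tree (\<lambda>v. \<xi> (i # v))"
      have sub: "(#) i ` ?S \<subseteq> T" using i by (auto simp: T Cons_in_family_tree_iff)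
      then have "finite ((#) i ` ?S)" using T(2) finite_subset by blast
      then have "finite ?S" by (rule finite_imageD) simp
      moreover have "length u < h \<and> \<xi> (i # u) \<le> K" if "u \<in> ?S" for u
        using bspec[OF v, of "i # u"] sub that by auto
      ultimately show ?thesis unfolding Suc.IH by blast
    qed
    moreover have "\<xi> [] \<le> K" using v T(1) family_tree.root by blast
    ultimately show "T \<in> bounded_trees K (Suc h)"
      unfolding T(1) family_tree_eq_graft[of \<xi>] bounded_trees.simps by (intro imageI) auto
  qed
qed

text \<open>The prefixes of \<open>v\<close> are \<open>length v + 1\<close> distinct vertices, and
  its children are \<open>\<xi> v\<close> distinct ones.\<close>

lemma family_tree_bounds:
  assumes "v \<in> family_tree \<xi>" "finite (family_tree \<xi>)"
  shows "length v < card (family_tree \<xi>)" "\<xi> v \<le> card (family_tree \<xi>)"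
proof -
  have "take i v \<in> family_tree \<xi>" for i
    using assms(1)
  proof (induction v rule: rev_induct)
    case (snoc j v)
    then show ?case
      by (cases "i \<le> length v") (auto simp: snoc_in_family_tree_iff)
  qed (simp add: family_tree.root)
  then have sub: "(\<lambda>i. take i v) ` {..length v} \<subseteq> family_tree \<xi>" by blast
  have inj: "inj_on (\<lambda>i. take i v) {..length v}"
    by (rule inj_onI) (metis atMost_iff length_take min.absorb2)
  show "length v < card (family_tree \<xi>)"
    using card_inj_on_le[OF inj sub assms(2)] by simp
  have sub: "(\<lambda>i. v @ [i]) ` {..<\<xi> v} \<subseteq> family_tree \<xi>"
    using assms(1) by (auto simp: snoc_in_family_tree_iff)
  have inj: "inj_on (\<lambda>i. v @ [i]) {..<\<xi> v}" by (simp add: inj_on_def)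
  show "\<xi> v \<le> card (family_tree \<xi>)"
    using card_inj_on_le[OF inj sub assms(2)] by simp
qed

lemma tree_height_less_iff:
  assumes "finite (family_tree \<xi>)"
  shows "tree_height (family_tree \<xi>) < h \<longleftrightarrow> (\<forall>v\<in>family_tree \<xi>. length v < h)"
proof -
  have "length ` family_tree \<xi> \<noteq> {}" using family_tree.root[of \<xi>] by blast
  then show ?thesis
    unfolding tree_height_def using assms by (subst Max_less_iff) simp_all
qed

section \<open>Bienayme trees\<close>

definition small_tree :: "nat \<Rightarrow> nat \<Rightarrow> nat list set \<Rightarrow> bool" where
  "small_tree n h T \<longleftrightarrow> has_size T n \<and> tree_height T < h"

lemma small_tree_iff_trees:
  assumes "n \<le> K"
  shows "small_tree n h (family_tree \<xi>) \<longleftrightarrow> family_tree \<xi> \<in> {T \<in> bounded_trees K h. card T = n}"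
proof
  assume "small_tree n h (family_tree \<xi>)"
  then show "family_tree \<xi> \<in> {T \<in> bounded_trees K h. card T = n}"
    using assms family_tree_bounds(2)[of _ \<xi>]
    by (force simp: small_tree_def has_size_def tree_height_less_iff trees_iff)
next
  assume T: "family_tree \<xi> \<in> {T \<in> bounded_trees K h. card T = n}"
  then have "finite (family_tree \<xi>)" "\<forall>v\<in>family_tree \<xi>. length v < h"
    unfolding mem_Collect_eq trees_iff by blast+
  then show "small_tree n h (family_tree \<xi>)"
    using T by (simp add: small_tree_def has_size_def tree_height_less_iff)
qed

text \<open>A tree with \<open>n\<close> vertices has height less than \<open>n\<close>, so
  \<open>prob_small_tree\<close> also covers the conditioning event.\<close>

lemma has_size_iff_small_tree: "has_size (family_tree \<xi>) n \<longleftrightarrow> small_tree n n (family_tree \<xi>)"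
  using family_tree_bounds(1)[of _ \<xi>] by (auto simp: small_tree_def has_size_def tree_height_less_iff)

lemma sets_small_tree: "{\<xi>. small_tree n h (family_tree \<xi>)} \<in> sets (branching \<mu>)"
  by (rule sets_family_tree) (simp add: small_tree_def has_size_def)

lemma prob_space_branching: "prob_space (branching \<mu>)"
  unfolding branching_def by (intro prob_space_PiM measure_pmf.prob_space_axioms)

lemma finite_bounded_multisets:
  assumes "finite A"
  shows "finite {m. set_mset m \<subseteq> A \<and> size m = n}"
proof (rule finite_subset)
  show "{m. set_mset m \<subseteq> A \<and> size m = n} \<subseteq> mset ` {xs. set xs \<subseteq> A \<and> length xs = n}"
  proof
    fix m assume "m \<in> {m. set_mset m \<subseteq> A \<and> size m = n}"
    moreover obtain xs where "mset xs = m" using ex_mset by blast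
    ultimately show "m \<in> mset ` {xs. set xs \<subseteq> A \<and> length xs = n}" by auto
  qed
qed (simp add: assms finite_lists_length_eq)

text \<open>The probability of a tree is a product over its vertices and so depends on its profile
  only; the trees are grouped by profile.\<close>

lemma prob_small_tree:
  assumes "n \<le> K"
  shows "\<P>(\<xi> in branching \<mu>. small_tree n h (family_tree \<xi>))
    = (\<Sum>m | set_mset m \<subseteq> {..K} \<and> size m = n. Poly_Mapping.lookup (genpoly K h) m * (\<Prod>k\<in>#m. pmf \<mu> k))"
proof -
  interpret prob_space "branching \<mu>" by (rule prob_space_branching)
  let ?S = "{T \<in> bounded_trees K h. card T = n}" and ?w = "\<lambda>m. \<Prod>k\<in>#m. pmf \<mu> k"
  let ?M = "{m. set_mset m \<subseteq> {..K} \<and> size m = n}"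
  have S: "finite ?S" by (simp add: finite_trees)
  have T: "{\<xi>. family_tree \<xi> = T} \<in> sets (branching \<mu>)
      \<and> prob {\<xi>. family_tree \<xi> = T} = ?w (profile T)" if "T \<in> ?S" for T
  proof -
    from that obtain d where d: "T = family_tree d" "finite (family_tree d)"
      unfolding mem_Collect_eq trees_iff by blast
    then have "prob {\<xi>. family_tree \<xi> = T} = (\<Prod>v\<in>family_tree d. pmf \<mu> (d v))"
      using prob_family_tree_eq[OF d(2)] by simp
    also have "\<dots> = ?w (profile T)"
      unfolding prod_mset_profile d(1) by (simp add: outdeg_family_tree)
    finally show ?thesis using sets_family_tree_eq[OF d(2)] d(1) by simp
  qed
  have M: "finite ?M" by (rule finite_bounded_multisets) simp
  have "{\<xi> \<in> space (branching \<mu>). small_tree n h (family_tree \<xi>)} = (\<Union>T\<in>?S. {\<xi>. family_tree \<xi> = T})"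
    using small_tree_iff_trees[OF assms] by auto
  then have "\<P>(\<xi> in branching \<mu>. small_tree n h (family_tree \<xi>)) = (\<Sum>T\<in>?S. prob {\<xi>. family_tree \<xi> = T})"
    using T S by (simp only:) (intro finite_measure_finite_Union, auto simp: disjoint_family_on_def)
  also have "\<dots> = (\<Sum>T\<in>?S. ?w (profile T))"
    using T by (intro sum.cong) auto
  also have "\<dots> = (\<Sum>m\<in>?M. \<Sum>T\<in>{T \<in> ?S. profile T = m}. ?w (profile T))"
    using profile_trees by (intro sum.group[symmetric] S M) (auto simp: size_profile)
  also have "\<dots> = (\<Sum>m\<in>?M. Poly_Mapping.lookup (genpoly K h) m * ?w m)"
  proof (rule sum.cong[OF refl])
    fix m assume "m \<in> ?M"
    then have "{T \<in> ?S. profile T = m} = {T \<in> bounded_trees K h. profile T = m}"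
      using size_profile by auto
    then show "(\<Sum>T\<in>{T \<in> ?S. profile T = m}. ?w (profile T)) = Poly_Mapping.lookup (genpoly K h) m * ?w m"
      by (simp add: lookup_genpoly)
  qed
  finally show ?thesis .
qed

text \<open>If size \<open>n\<close> has probability 0, both sides are 0.\<close>

lemma prob_cond_branching:
  fixes t :: real
  shows "\<P>(\<xi> in cond_branching \<mu> n. real (tree_height (family_tree \<xi>)) \<le> t)
    = \<P>(\<xi> in branching \<mu>. small_tree n (nat (\<lfloor>t\<rfloor> + 1)) (family_tree \<xi>))
      / \<P>(\<xi> in branching \<mu>. small_tree n n (family_tree \<xi>))"
proof -
  interpret prob_space "branching \<mu>" by (rule prob_space_branching)
  let ?A = "{\<xi>. small_tree n n (family_tree \<xi>)}"
  let ?B = "{\<xi>. real (tree_height (family_tree \<xi>)) \<le> t}"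
  have A: "?A \<in> events" by (rule sets_small_tree)
  have B: "?B \<in> events"
    using measurable_sets[OF measurable_tree_height[of \<mu>], of "{..t}"] by (simp add: vimage_def)
  \<comment> \<open>For \<open>t < 0\<close> both sides are false, as \<open>nat\<close> then yields
    0.\<close>
  have le: "real k \<le> t \<longleftrightarrow> k < nat (\<lfloor>t\<rfloor> + 1)" for k by linarith
  have AB: "?A \<inter> ?B = {\<xi>. small_tree n (nat (\<lfloor>t\<rfloor> + 1)) (family_tree \<xi>)}"
    by (auto simp: le has_size_iff_small_tree[symmetric]) (auto simp: small_tree_def)
  have "\<P>(\<xi> in cond_branching \<mu> n. real (tree_height (family_tree \<xi>)) \<le> t)
      = measure (uniform_measure (branching \<mu>) ?A) ?B"
    by (simp add: cond_branching_def has_size_iff_small_tree)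
  also have "\<dots> = prob (?A \<inter> ?B) / prob ?A"
  proof (cases "emeasure (branching \<mu>) ?A = 0")
    case True
    then have "emeasure (branching \<mu>) (?A \<inter> ?B) = 0"
      using A B by (metis emeasure_mono inf_le1 le_zero_eq)
    then show ?thesis using True A B by (simp add: measure_def)
  next
    case False
    then show ?thesis using A B by (intro measure_uniform_measure) auto
  qed
  finally show ?thesis by (simp add: AB)
qed

text \<open>Only one profile of size \<open>n\<close> has trees of positive probability under
  \<open>\<nu>\<close>, and its weight cancels in the quotient.\<close>

lemma prob_cond_binary:
  assumes "pmf \<nu> 0 = 1/2" "pmf \<nu> 2 = 1/2" "odd n" "n \<le> K" "2 \<le> K"
  shows "\<P>(\<xi> in cond_branching \<nu> n. real (tree_height (family_tree \<xi>)) \<le> t)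
    = ratio K (nat (\<lfloor>t\<rfloor> + 1)) (binary_profile n)"
proof -
  let ?w = "\<lambda>m. \<Prod>k\<in>#m. pmf \<nu> k"
  have zero: "pmf \<nu> k = 0" if "k \<notin> {0, 2}" for k
  proof -
    have "(\<Sum>j\<in>{0, 2, k}. pmf \<nu> j) \<le> 1"
      using measure_pmf.prob_le_1[of \<nu> "{0, 2, k}"] by (simp only: measure_measure_pmf_finite finite.intros)
    then have "pmf \<nu> 0 + (pmf \<nu> 2 + pmf \<nu> k) \<le> 1" using that by simp
    then have "pmf \<nu> k \<le> 0" using assms(1,2) by linarith
    then show ?thesis using pmf_nonneg[of \<nu> k] by linarith
  qed
  have size: "size (binary_profile n) = n" using assms(3) by (auto simp: binary_profile_def elim: oddE)
  have binary: "set_mset (binary_profile n) \<subseteq> {0, 2}" by (auto simp: binary_profile_def)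
  have "\<P>(\<xi> in branching \<nu>. small_tree n h (family_tree \<xi>))
      = Poly_Mapping.lookup (genpoly K h) (binary_profile n) * ?w (binary_profile n)" for h
  proof -
    have "Poly_Mapping.lookup (genpoly K h) m * ?w m = 0" if "size m = n" "m \<noteq> binary_profile n" for m
    proof (rule ccontr)
      assume "\<not> ?thesis"
      then have *: "sum_mset m + 1 = size m" and "\<forall>k\<in>#m. pmf \<nu> k \<noteq> 0"
        using lookup_genpoly_nonzeroD by auto
      then have m: "set_mset m \<subseteq> {0, 2}" using zero by blast
      then have "count m 1 = 0" by (auto simp: count_eq_zero_iff)
      then have "m = binary_profile (size m)"
        using m * that assms(3) by (intro eq_binary_profile) auto
      then show False using that by simp
    qed
    then have "(\<Sum>m | set_mset m \<subseteq> {..K} \<and> size m = n. Poly_Mapping.lookup (genpoly K h) m * ?w m)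
        = (\<Sum>m\<in>{binary_profile n}. Poly_Mapping.lookup (genpoly K h) m * ?w m)"
      using binary size assms(5)
      by (intro sum.mono_neutral_right finite_bounded_multisets) auto
    then show ?thesis unfolding prob_small_tree[OF assms(4)] by simp
  qed
  moreover have "?w (binary_profile n) \<noteq> 0" using assms(1,2) by (simp add: binary_profile_def)
  ultimately show ?thesis
    by (simp add: prob_cond_branching ratio_def size)
qed

text \<open>The probability is an average of \<open>ratio K h m\<close> over the profiles
  \<open>m\<close> of positive weight, and these contain no 1 because
  \<open>pmf \<mu> 1 = 0\<close>.\<close>

lemma prob_cond_ge:
  assumes "pmf \<mu> 1 = 0" "\<P>(\<xi> in branching \<mu>. has_size (family_tree \<xi>) n) > 0" "n \<le> K"
    and ratio: "\<And>h m. set_mset m \<subseteq> {..K} \<Longrightarrow> sum_mset m + 1 = size m \<Longrightarrow> size m = n \<Longrightarrow> 1 \<notin># m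
      \<Longrightarrow> r h \<le> ratio K h m"
  shows "r (nat (\<lfloor>t\<rfloor> + 1)) \<le> \<P>(\<xi> in cond_branching \<mu> n. real (tree_height (family_tree \<xi>)) \<le> t)"
proof -
  let ?P = "\<lambda>h. \<P>(\<xi> in branching \<mu>. small_tree n h (family_tree \<xi>))"
  let ?h = "nat (\<lfloor>t\<rfloor> + 1)" and ?w = "\<lambda>m. \<Prod>k\<in>#m. pmf \<mu> k"
  have "r ?h * ?P n \<le> ?P ?h"
    unfolding prob_small_tree[OF assms(3)] sum_distrib_left
  proof (rule sum_mono)
    fix m assume m: "m \<in> {m. set_mset m \<subseteq> {..K} \<and> size m = n}"
    let ?a = "Poly_Mapping.lookup (genpoly K n) m" and ?b = "Poly_Mapping.lookup (genpoly K ?h) m"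
    have w: "0 \<le> ?w m" by (induction m) simp_all
    show "r ?h * (?a * ?w m) \<le> ?b * ?w m"
    proof (cases "?a * ?w m = 0")
      case True
      have "0 \<le> ?b * ?w m" using w lookup_genpoly_nonneg by simp
      then show ?thesis using True by (simp only: mult_zero_right)
    next
      case False
      then have "r ?h \<le> ratio K ?h m"
        using m assms(1) lookup_genpoly_nonzeroD(2)[of K n m] by (intro ratio) auto
      also have "\<dots> = ?b / ?a" using m by (simp add: ratio_def)
      finally have "r ?h * ?a \<le> ?b"
        using False lookup_genpoly_nonneg[of K n m] by (simp add: pos_le_divide_eq)
      then show ?thesis using w by (simp add: mult_right_mono flip: mult.assoc)
    qed
  qed
  moreover have "?P n > 0" using assms(2) by (simp add: has_size_iff_small_tree)
  ultimately show ?thesis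
    by (simp add: prob_cond_branching pos_le_divide_eq)
qed

theorem theorem5:
  fixes \<mu> \<nu> :: "nat pmf" and n :: nat
  assumes "0 < pmf \<mu> 0" and "pmf \<mu> 0 < 1" and "pmf \<mu> 1 = 0"
    and "pmf \<nu> 0 = 1/2" and "pmf \<nu> 2 = 1/2"
    and "n \<ge> 1"
    and "\<P>(\<xi> in branching \<mu>. has_size (family_tree \<xi>) n) > 0"
  shows "(odd n \<longrightarrow> stoch_le (cond_branching \<mu> n) (\<lambda>\<xi>. real (tree_height (family_tree \<xi>)))
                          (cond_branching \<nu> n) (\<lambda>\<xi>. real (tree_height (family_tree \<xi>)))) \<and>
         (even n \<longrightarrow> stoch_le (cond_branching \<mu> n) (\<lambda>\<xi>. real (tree_height (family_tree \<xi>)))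
                          (cond_branching \<nu> (n + 1)) (\<lambda>\<xi>. real (tree_height (family_tree \<xi>))))"
proof -
  define n' where "n' = (if odd n then n else n + 1)"
  \<comment> \<open>Large enough for trees with \<open>n\<close> as well as \<open>n'\<close>
    vertices, and at least 2.\<close>
  define K where "K = n + 1"
  have K: "n \<le> K" "n' \<le> K" "2 \<le> K" "odd n'" using assms(6) by (auto simp: n'_def K_def)
  have "ratio K h (binary_profile n') \<le> ratio K h m"
    if m: "set_mset m \<subseteq> {..K}" "sum_mset m + 1 = size m" "size m = n" "1 \<notin># m" for h m
  proof (cases "odd n")
    case True
    then show ?thesis
      using m ratio_binary_profile_le[of m K h] by (simp add: n'_def not_in_iff)
  next
    case False
    \<comment> \<open>The added entry makes the size odd and is the only 1, as
      \<open>ratio_binary_profile_le\<close> demands.\<close>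
    then have "ratio K h (binary_profile n') \<le> ratio K h (add_mset 1 m)"
      using m K ratio_binary_profile_le[of "add_mset 1 m" K h] by (simp add: n'_def not_in_iff)
    also have "\<dots> \<le> ratio K h m"
      using m(3) K assms(6) by (intro ratio_add_1) auto
    finally show ?thesis .
  qed
  then have "stoch_le (cond_branching \<mu> n) (\<lambda>\<xi>. real (tree_height (family_tree \<xi>)))
      (cond_branching \<nu> n') (\<lambda>\<xi>. real (tree_height (family_tree \<xi>)))"
    unfolding stoch_le_def prob_cond_binary[OF assms(4,5) K(4,2,3)]
    using prob_cond_ge[where r = "\<lambda>h. ratio K h (binary_profile n')", OF assms(3,7) K(1)] by blast
  then show ?thesis by (cases "odd n") (simp_all add: n'_def)
qed

end
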